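(* Let $\Lambda=\{\lambda_n\}_{n=1}^{\infty}$ be a strictly increasing sequence of positive real numbers such that $\sum_{n=1}^{\infty}\frac{1}{\lambda_n}<\infty$ and $\inf_{n}(\lambda_{n+1}-\lambda_n)>0$. Let $M_\Lambda=\{e_n\}_{n=1}^\infty$ with $e_n(t)=t^{\lambda_n}$, let $\overline{M_\Lambda}$ be the closed span of $M_\Lambda$ in $L^2(0,1)$, and let $r_\Lambda=\{r_n\}_{n=1}^\infty$ be the unique biorthogonal family of $M_\Lambda$ in $\overline{M_\Lambda}$. Then the following are true. (I) Each function $f\in\overline{M_\Lambda}$ extends as an analytic function in the slit disk $\mathbb{D}\setminus(-1,0]$, so that $$f(z)=\sum_{n=1}^{\infty}\langle f,r_n\rangle z^{\lambda_n},$$ the series converging uniformly on compact subsets of $\mathbb{D}\setminus(-1,0)$. (II) For each function $f\in L^2(0,1)$ its associated series $$f^*(x):=\sum_{n=1}^{\infty}\langle f,r_n\rangle x^{\lambda_n}$$ is analytic in $\mathbb{D}\setminus(-1,0]$ and (restricted to $(0,1)$) belongs to the space $\overline{M_\Lambda}$. (III) The system $M_\Lambda$ is a Markushevich basis for $\overline{M_\Lambda}$. (IV) The system $M_\Lambda$ is a strong Markushevich basis for $\overline{M_\Lambda}$.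
   Context: $L^2(0,1)$ is the complex Hilbert space with inner product $\langle f,g\rangle=\int_0^1 f(t)\overline{g(t)}\,dt$. $\mathbb{D}=\{z\in\mathbb{C}:|z|<1\}$. Powers $z^{\lambda_n}$ use the principal branch of the logarithm on $\mathbb{C}\setminus(-\infty,0]$, with $0^{\lambda_n}=0$. The statement that $f\in\overline{M_\Lambda}$ "extends" to an analytic function means that $f$ agrees almost everywhere on $(0,1)$ with the restriction of that analytic function. Under the stated hypotheses on $\Lambda$ the system $M_\Lambda$ is minimal (no $e_n$ belongs to the closed span of the others in $L^2(0,1)$), so there is a unique family $r_\Lambda=\{r_n\}_{n=1}^\infty\subset\overline{M_\Lambda}$ that is biorthogonal to $M_\Lambda$, i.e. $\langle e_n,r_m\rangle=1$ if $m=n$ and $0$ if $m\neq n$. $M_\Lambda$ is a Markushevich basis for $\overline{M_\Lambda}$ if it is complete (its closed span is $\overline{M_\Lambda}$) and minimal in $\overline{M_\Lambda}$, and the closed span of its biorthogonal family $r_\Lambda$ in $L^2(0,1)$ is also equal to $\overline{M_\Lambda}$. It is a strong Markushevich basis (equivalently, a hereditarily complete system) for $\overline{M_\Lambda}$ if for every partition $\mathbb{N}=N_1\cup N_2$ into two disjoint sets, the closed span in $L^2(0,1)$ of the mixed system $\{e_n: n\in N_1\}\cup\{r_n:n\in N_2\}$ is equal to $\overline{M_\Lambda}$. *)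

theory Defs
  imports "HOL-Analysis.Analysis"
begin

text \<open>
  The space \<open>L\<^sup>2(0,1)\<close> is represented by functions rather than by classes of functions: two functions
  stand for the same vector iff they agree almost everywhere on \<open>(0,1)\<close>. All notions below are
  invariant under such changes (in particular, every closed span is closed under them, since
  Lebesgue measure is complete), and values outside \<open>(0,1)\<close> never matter.
\<close>

abbreviation unit_lebesgue :: "real measure" where
  "unit_lebesgue \<equiv> lebesgue_on {0<..<1}"

definition L2_01 :: "(real \<Rightarrow> complex) set" where
  "L2_01 = {f. f \<in> borel_measurable unit_lebesgue \<and>
               integrable unit_lebesgue (\<lambda>t. (cmod (f t))\<^sup>2)}"

definition L2_inner :: "(real \<Rightarrow> complex) \<Rightarrow> (real \<Rightarrow> complex) \<Rightarrow> complex" where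
  "L2_inner f g = (LINT t|unit_lebesgue. f t * cnj (g t))"

definition L2_norm :: "(real \<Rightarrow> complex) \<Rightarrow> real" where
  "L2_norm f = sqrt (LINT t|unit_lebesgue. (cmod (f t))\<^sup>2)"

definition complex_span :: "(real \<Rightarrow> complex) set \<Rightarrow> (real \<Rightarrow> complex) set" where
  "complex_span S = {g. \<exists>T c. finite T \<and> T \<subseteq> S \<and> g = (\<lambda>t. \<Sum>h\<in>T. c h * h t)}"

text \<open>Meaningful for \<open>S \<subseteq> L2_01\<close> only: \<open>L2_norm\<close> is \<open>0\<close> on functions that are not square integrable.\<close>

definition closed_span :: "(real \<Rightarrow> complex) set \<Rightarrow> (real \<Rightarrow> complex) set" where
  "closed_span S =
     {f \<in> L2_01. \<forall>\<epsilon>>0. \<exists>g \<in> complex_span S. L2_norm (\<lambda>t. f t - g t) < \<epsilon>}"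

definition minimal_system :: "(nat \<Rightarrow> real \<Rightarrow> complex) \<Rightarrow> bool" where
  "minimal_system x \<longleftrightarrow> (\<forall>n. x n \<notin> closed_span (x ` (UNIV - {n})))"

definition biorthogonal_family ::
    "(real \<Rightarrow> complex) set \<Rightarrow> (nat \<Rightarrow> real \<Rightarrow> complex) \<Rightarrow> (nat \<Rightarrow> real \<Rightarrow> complex) \<Rightarrow> bool" where
  "biorthogonal_family H x r \<longleftrightarrow>
     (\<forall>n. r n \<in> H) \<and> (\<forall>m n. L2_inner (x n) (r m) = (if m = n then 1 else 0))"

text \<open>
  In the next two definitions \<open>r\<close> is the biorthogonal family of \<open>x\<close> in \<open>H\<close>; for \<open>H\<close> the closed span
  of \<open>x\<close> it is determined by \<open>x\<close> up to null sets.
\<close>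

definition markushevich_basis ::
    "(real \<Rightarrow> complex) set \<Rightarrow> (nat \<Rightarrow> real \<Rightarrow> complex) \<Rightarrow> (nat \<Rightarrow> real \<Rightarrow> complex) \<Rightarrow> bool" where
  "markushevich_basis H x r \<longleftrightarrow>
     closed_span (range x) = H \<and> minimal_system x \<and>
     biorthogonal_family H x r \<and> closed_span (range r) = H"

definition strong_markushevich_basis ::
    "(real \<Rightarrow> complex) set \<Rightarrow> (nat \<Rightarrow> real \<Rightarrow> complex) \<Rightarrow> (nat \<Rightarrow> real \<Rightarrow> complex) \<Rightarrow> bool" where
  "strong_markushevich_basis H x r \<longleftrightarrow>
     biorthogonal_family H x r \<and>
     (\<forall>N1 N2. N1 \<union> N2 = UNIV \<and> N1 \<inter> N2 = {} \<longrightarrow> closed_span (x ` N1 \<union> r ` N2) = H)"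

definition muntz_system :: "(nat \<Rightarrow> real) \<Rightarrow> nat \<Rightarrow> real \<Rightarrow> complex" where
  "muntz_system \<Lambda> n t = complex_of_real (t powr \<Lambda> n)"

definition muntz_space :: "(nat \<Rightarrow> real) \<Rightarrow> (real \<Rightarrow> complex) set" where
  "muntz_space \<Lambda> = closed_span (range (muntz_system \<Lambda>))"

text \<open>Complex \<open>powr\<close> uses the principal branch of the logarithm and satisfies \<open>0 powr w = 0\<close>.\<close>

definition series_term ::
    "(nat \<Rightarrow> real) \<Rightarrow> (nat \<Rightarrow> real \<Rightarrow> complex) \<Rightarrow> (real \<Rightarrow> complex) \<Rightarrow> complex \<Rightarrow> nat \<Rightarrow> complex" where
  "series_term \<Lambda> r f z n = L2_inner f (r n) * z powr complex_of_real (\<Lambda> n)"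

definition assoc_series ::
    "(nat \<Rightarrow> real) \<Rightarrow> (nat \<Rightarrow> real \<Rightarrow> complex) \<Rightarrow> (real \<Rightarrow> complex) \<Rightarrow> complex \<Rightarrow> complex" where
  "assoc_series \<Lambda> r f z = (\<Sum>n. series_term \<Lambda> r f z n)"

text \<open>\<open>slit_disk\<close> omits the origin, \<open>slit_disk0\<close> contains it.\<close>

definition slit_disk :: "complex set" where
  "slit_disk = ball 0 1 - complex_of_real ` {-1<..0}"

definition slit_disk0 :: "complex set" where
  "slit_disk0 = ball 0 1 - complex_of_real ` {-1<..<0}"

end

theory Submission
  imports Defs "HOL-Complex_Analysis.Complex_Analysis"
begin

text \<open>
  In the span of \<open>e\<^sub>k\<close>, \<open>k < N\<close>, the vector biorthogonal to \<open>e\<^sub>n\<close> is explicit: its coefficients are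
  the residues of the rational function with poles \<open>- \<lambda>\<^sub>j - 1\<close> that is \<open>1\<close> at \<open>\<lambda>\<^sub>n\<close> and \<open>0\<close> at the other
  \<open>\<lambda>\<^sub>k\<close>. Its squared norm is \<open>2 \<lambda>\<^sub>n + 1\<close> times the square of the product of
  \<open>(\<lambda>\<^sub>n + \<lambda>\<^sub>k + 1) / \<bar>\<lambda>\<^sub>n - \<lambda>\<^sub>k\<bar>\<close> over \<open>k \<noteq> n\<close>. Summability of \<open>1 / \<lambda>\<^sub>k\<close> and the gap condition
  bound this product by \<open>C exp (\<epsilon> \<lambda>\<^sub>n)\<close> for every \<open>\<epsilon> > 0\<close>, uniformly in \<open>N\<close>. Hence the coefficients
  \<open>\<langle>f, r\<^sub>n\<rangle>\<close> grow subexponentially in \<open>\<lambda>\<^sub>n\<close>, their series converges on the slit disk, and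
  it represents \<open>f\<close> because this is true on the span and both sides depend continuously on \<open>f\<close>.

  For hereditary completeness, let \<open>f\<close> in the closed span be orthogonal to \<open>r\<^sub>n\<close> for \<open>n \<in> N\<^sub>2\<close>. The
  dilations \<open>t \<mapsto> f (s t)\<close>, \<open>s < 1\<close>, have expansions that converge uniformly on \<open>(0,1)\<close> and involve only
  \<open>e\<^sub>n\<close> with \<open>n \<in> N\<^sub>1\<close>; letting \<open>s\<close> tend to \<open>1\<close>, \<open>f\<close> lies in the closed span of these. If \<open>f\<close> is also
  orthogonal to \<open>e\<^sub>n\<close> for \<open>n \<in> N\<^sub>1\<close>, then \<open>f = 0\<close>.
\<close>

section \<open>Square-integrable functions\<close>

lemma L2_01D:
  assumes "f \<in> L2_01"
  shows "f \<in> borel_measurable unit_lebesgue"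
    and "integrable unit_lebesgue (\<lambda>t. (cmod (f t))\<^sup>2)"
  using assms by (auto simp: L2_01_def)

lemma L2_01_bound:
  assumes f: "f \<in> borel_measurable unit_lebesgue"
    and g: "integrable unit_lebesgue g"
    and le: "\<And>t. (cmod (f t))\<^sup>2 \<le> g t"
  shows "f \<in> L2_01"
  unfolding L2_01_def
proof (safe intro!: f)
  show "integrable unit_lebesgue (\<lambda>t. (cmod (f t))\<^sup>2)"
  proof (rule Bochner_Integration.integrable_bound[OF g])
    show "(\<lambda>t. (cmod (f t))\<^sup>2) \<in> borel_measurable unit_lebesgue"
      using f by measurable
    have "norm ((cmod (f t))\<^sup>2) \<le> norm (g t)" for t
      using le[of t] by simp
    then show "AE t in unit_lebesgue. norm ((cmod (f t))\<^sup>2) \<le> norm (g t)"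
      by simp
  qed
qed

lemma L2_01_add:
  assumes "f \<in> L2_01" "g \<in> L2_01"
  shows "(\<lambda>t. f t + g t) \<in> L2_01"
proof (rule L2_01_bound)
  note [measurable] = L2_01D(1)[OF assms(1)] L2_01D(1)[OF assms(2)]
  show "(\<lambda>t. f t + g t) \<in> borel_measurable unit_lebesgue"
    by measurable
  show "integrable unit_lebesgue (\<lambda>t. 2 * (cmod (f t))\<^sup>2 + 2 * (cmod (g t))\<^sup>2)"
    using L2_01D(2)[OF assms(1)] L2_01D(2)[OF assms(2)] by simp
  fix t
  have "(cmod (f t + g t))\<^sup>2 \<le> (cmod (f t) + cmod (g t))\<^sup>2"
    by (intro power_mono norm_triangle_ineq) simp
  also have "\<dots> \<le> 2 * (cmod (f t))\<^sup>2 + 2 * (cmod (g t))\<^sup>2"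
    using sum_squares_bound[of "cmod (f t)" "cmod (g t)"] by (simp add: power2_sum)
  finally show "(cmod (f t + g t))\<^sup>2 \<le> 2 * (cmod (f t))\<^sup>2 + 2 * (cmod (g t))\<^sup>2" .
qed

lemma L2_01_scale:
  assumes "f \<in> L2_01"
  shows "(\<lambda>t. c * f t) \<in> L2_01"
proof (rule L2_01_bound)
  note [measurable] = L2_01D(1)[OF assms(1)]
  show "(\<lambda>t. c * f t) \<in> borel_measurable unit_lebesgue"
    by measurable
  show "integrable unit_lebesgue (\<lambda>t. (cmod c)\<^sup>2 * (cmod (f t))\<^sup>2)"
    using L2_01D(2)[OF assms(1)] by simp
qed (simp add: norm_mult power_mult_distrib)

lemma L2_01_zero: "(\<lambda>t. 0) \<in> L2_01"
  by (simp add: L2_01_def)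

lemma L2_01_diff:
  assumes "f \<in> L2_01" "g \<in> L2_01"
  shows "(\<lambda>t. f t - g t) \<in> L2_01"
  using L2_01_add[OF assms(1) L2_01_scale[OF assms(2), of "-1"]] by simp

lemma L2_01_sum:
  assumes "\<And>i. i \<in> I \<Longrightarrow> f i \<in> L2_01"
  shows "(\<lambda>t. \<Sum>i\<in>I. f i t) \<in> L2_01"
  using assms
  by (induction I rule: infinite_finite_induct) (auto intro: L2_01_zero L2_01_add)

text \<open>Extension by zero moves the question to the whole line, where completeness of Lebesgue
  measure makes \<open>g\<close> measurable.\<close>

lemma L2_01_cong_AE:
  assumes f: "f \<in> L2_01" and ae: "AE t in unit_lebesgue. f t = g t"
  shows "g \<in> L2_01"
proof -
  note [measurable] = L2_01D(1)[OF f]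
  have "(\<lambda>t. if t \<in> {0<..<1} then f t else 0) \<in> borel_measurable lebesgue"
    using L2_01D(1)[OF f] by (subst borel_measurable_if) auto
  moreover have "AE t in lebesgue. (if t \<in> {0<..<1} then f t else 0) = (if t \<in> {0<..<1} then g t else 0)"
    using ae by (subst (asm) AE_restrict_space_iff) (auto elim: eventually_mono)
  ultimately have "(\<lambda>t. if t \<in> {0<..<1} then g t else 0) \<in> borel_measurable lebesgue"
    by (rule borel_measurable_AE)
  then have g [measurable]: "g \<in> borel_measurable unit_lebesgue"
    by (subst (asm) borel_measurable_if) auto
  have "integrable unit_lebesgue (\<lambda>t. (cmod (f t))\<^sup>2) \<longleftrightarrow> integrable unit_lebesgue (\<lambda>t. (cmod (g t))\<^sup>2)"
    using ae by (intro integrable_cong_AE) (auto elim: eventually_mono)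
  with L2_01D(2)[OF f] g show ?thesis
    by (simp add: L2_01_def)
qed

lemma L2_norm_cong_AE:
  assumes f: "f \<in> L2_01" and ae: "AE t in unit_lebesgue. f t = g t"
  shows "L2_norm f = L2_norm g"
proof -
  note [measurable] = L2_01D(1)[OF f] L2_01D(1)[OF L2_01_cong_AE[OF f ae]]
  show ?thesis
    unfolding L2_norm_def using ae
    by (intro arg_cong[where f = sqrt] integral_cong_AE) (auto elim: eventually_mono)
qed

section \<open>Inner product, norm and the Cauchy-Schwarz inequality\<close>

lemma L2_inner_integrable:
  assumes "f \<in> L2_01" "g \<in> L2_01"
  shows "integrable unit_lebesgue (\<lambda>t. f t * cnj (g t))"
proof (rule Bochner_Integration.integrable_bound)
  note [measurable] = L2_01D(1)[OF assms(1)] L2_01D(1)[OF assms(2)]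
  show "integrable unit_lebesgue (\<lambda>t. (cmod (f t))\<^sup>2 + (cmod (g t))\<^sup>2)"
    using L2_01D(2)[OF assms(1)] L2_01D(2)[OF assms(2)] by simp
  have [measurable]: "cnj \<in> borel_measurable borel"
    by (intro borel_measurable_continuous_onI continuous_intros)
  show "(\<lambda>t. f t * cnj (g t)) \<in> borel_measurable unit_lebesgue"
    by measurable
  have "norm (f t * cnj (g t)) \<le> norm ((cmod (f t))\<^sup>2 + (cmod (g t))\<^sup>2)" for t
  proof -
    have "0 \<le> cmod (f t) * cmod (g t)" by simp
    then show ?thesis
      using sum_squares_bound[of "cmod (f t)" "cmod (g t)"] by (simp add: norm_mult del: mult_nonneg_nonneg zero_le_mult_iff)
  qed
  then show "AE t in unit_lebesgue. norm (f t * cnj (g t)) \<le> norm ((cmod (f t))\<^sup>2 + (cmod (g t))\<^sup>2)"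
    by simp
qed

lemma L2_inner_diff_left:
  assumes "f \<in> L2_01" "g \<in> L2_01" "h \<in> L2_01"
  shows "L2_inner (\<lambda>t. f t - g t) h = L2_inner f h - L2_inner g h"
  unfolding L2_inner_def using assms
  by (simp add: left_diff_distrib L2_inner_integrable)

lemma L2_inner_scale_left: "L2_inner (\<lambda>t. c * f t) h = c * L2_inner f h"
  unfolding L2_inner_def by (simp add: mult.assoc)

lemma L2_inner_sum_left:
  assumes "\<And>i. i \<in> I \<Longrightarrow> f i \<in> L2_01" "h \<in> L2_01"
  shows "L2_inner (\<lambda>t. \<Sum>i\<in>I. c i * f i t) h = (\<Sum>i\<in>I. c i * L2_inner (f i) h)"
  unfolding L2_inner_def using assms
  by (simp add: sum_distrib_right L2_inner_integrable mult.assoc)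

lemma L2_inner_commute: "L2_inner g f = cnj (L2_inner f g)"
  unfolding L2_inner_def by (subst Bochner_Integration.integral_cnj[symmetric]) (simp add: mult.commute)

lemma L2_inner_self: "L2_inner f f = complex_of_real ((L2_norm f)\<^sup>2)"
  unfolding L2_inner_def L2_norm_def
  by (simp flip: complex_norm_square of_real_power add: Bochner_Integration.integral_nonneg)

lemma L2_norm_nonneg: "0 \<le> L2_norm f"
  unfolding L2_norm_def by (simp add: Bochner_Integration.integral_nonneg)

lemma L2_norm_power2: "(L2_norm f)\<^sup>2 = (LINT t|unit_lebesgue. (cmod (f t))\<^sup>2)"
  unfolding L2_norm_def by (simp add: Bochner_Integration.integral_nonneg)

lemma L2_norm_scale: "L2_norm (\<lambda>t. c * f t) = cmod c * L2_norm f"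
  unfolding L2_norm_def by (simp add: norm_mult power_mult_distrib real_sqrt_mult)

lemma L2_norm_minus_commute: "L2_norm (\<lambda>t. f t - g t) = L2_norm (\<lambda>t. g t - f t)"
  unfolding L2_norm_def by (simp add: norm_minus_commute)

text \<open>The inequality \<open>2 a b \<le> (q / p) a^2 + (p / q) b^2\<close> is integrated with
  \<open>p\<close> and \<open>q\<close> slightly above the two norms, so that a vanishing norm
  causes no division by zero. The modulus stands inside the integral because
  \<open>AE_summable_L2\<close> needs an L1 bound.\<close>

lemma L2_Cauchy_Schwarz_abs:
  assumes f: "f \<in> L2_01" and g: "g \<in> L2_01"
  shows "(LINT t|unit_lebesgue. cmod (f t * cnj (g t))) \<le> L2_norm f * L2_norm g"
proof (rule field_le_epsilon)
  note [simp] = L2_01D(2)[OF f] L2_01D(2)[OF g] L2_norm_nonneg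
  let ?I = "LINT t|unit_lebesgue. cmod (f t * cnj (g t))"
  have *: "?I \<le> (L2_norm f + d) * (L2_norm g + d)" if d: "0 < d" for d
  proof -
    define p where "p = L2_norm f + d"
    define q where "q = L2_norm g + d"
    have pq: "0 < p" "0 < q" "L2_norm f \<le> p" "L2_norm g \<le> q"
      using d by (simp_all add: p_def q_def add_nonneg_pos)
    have "?I \<le> (LINT t|unit_lebesgue. (q / p * (cmod (f t))\<^sup>2 + p / q * (cmod (g t))\<^sup>2) / 2)"
    proof (rule integral_mono)
      show "integrable unit_lebesgue (\<lambda>t. cmod (f t * cnj (g t)))"
        using L2_inner_integrable[OF f g] by (rule integrable_norm)
      show "integrable unit_lebesgue (\<lambda>t. (q / p * (cmod (f t))\<^sup>2 + p / q * (cmod (g t))\<^sup>2) / 2)"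
        by simp
      fix t
      have "0 \<le> (q * cmod (f t) - p * cmod (g t))\<^sup>2" by simp
      then have "2 * (p * q) * (cmod (f t) * cmod (g t)) \<le> q\<^sup>2 * (cmod (f t))\<^sup>2 + p\<^sup>2 * (cmod (g t))\<^sup>2"
        by (simp add: power2_diff power_mult_distrib algebra_simps)
      also have "\<dots> = (p * q) * (q / p * (cmod (f t))\<^sup>2 + p / q * (cmod (g t))\<^sup>2)"
        using pq by (simp add: field_simps power2_eq_square)
      finally have "(p * q) * (2 * (cmod (f t) * cmod (g t))) \<le> (p * q) * (q / p * (cmod (f t))\<^sup>2 + p / q * (cmod (g t))\<^sup>2)"
        by (simp add: mult_ac)
      then show "cmod (f t * cnj (g t)) \<le> (q / p * (cmod (f t))\<^sup>2 + p / q * (cmod (g t))\<^sup>2) / 2"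
        using pq by (simp add: norm_mult)
    qed
    also have "\<dots> = (q / p * (L2_norm f)\<^sup>2 + p / q * (L2_norm g)\<^sup>2) / 2"
      by (simp add: L2_norm_power2)
    also have "\<dots> \<le> (q / p * p\<^sup>2 + p / q * q\<^sup>2) / 2"
      using pq by (intro divide_right_mono add_mono mult_left_mono power_mono) auto
    also have "\<dots> = p * q"
      using pq by (simp add: power2_eq_square)
    finally show ?thesis by (simp add: p_def q_def)
  qed
  fix e :: real assume e: "0 < e"
  \<comment> \<open>For \<open>d \<le> 1\<close> the product exceeds
    \<open>L2_norm f * L2_norm g\<close> by at most \<open>d * S\<close>, which dictates the choice
    of \<open>d\<close>.\<close>
  define S where "S = L2_norm f + L2_norm g + 1"
  define d where "d = min 1 (e / S)"
  have S: "S \<ge> 1" by (simp add: S_def)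
  have d: "0 < d" "d \<le> 1" "d * S \<le> e"
    using S e by (auto simp: d_def min_def field_simps)
  have "(L2_norm f + d) * (L2_norm g + d) = L2_norm f * L2_norm g + d * (L2_norm f + L2_norm g + d)"
    by (simp add: algebra_simps)
  also have "\<dots> \<le> L2_norm f * L2_norm g + d * S"
    using d by (intro add_left_mono mult_left_mono) (auto simp: S_def)
  finally show "?I \<le> L2_norm f * L2_norm g + e"
    using *[OF d(1)] d(3) by linarith
qed

lemma L2_Cauchy_Schwarz:
  assumes "f \<in> L2_01" "g \<in> L2_01"
  shows "cmod (L2_inner f g) \<le> L2_norm f * L2_norm g"
  using integral_norm_bound[of unit_lebesgue "\<lambda>t. f t * cnj (g t)"] L2_Cauchy_Schwarz_abs[OF assms]
  unfolding L2_inner_def by linarith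

lemma L2_norm_add_power2:
  assumes f: "f \<in> L2_01" and g: "g \<in> L2_01"
  shows "(L2_norm (\<lambda>t. f t + g t))\<^sup>2 = (L2_norm f)\<^sup>2 + 2 * Re (L2_inner f g) + (L2_norm g)\<^sup>2"
proof -
  have "(L2_norm (\<lambda>t. f t + g t))\<^sup>2 =
      (LINT t|unit_lebesgue. (cmod (f t))\<^sup>2 + 2 * Re (f t * cnj (g t)) + (cmod (g t))\<^sup>2)"
    unfolding L2_norm_power2
    by (intro Bochner_Integration.integral_cong refl) (simp add: cmod_power2, simp add: power2_eq_square algebra_simps)
  also have "\<dots> = (L2_norm f)\<^sup>2 + 2 * (LINT t|unit_lebesgue. Re (f t * cnj (g t))) + (L2_norm g)\<^sup>2"
    unfolding L2_norm_power2
    using L2_inner_integrable[OF f g, THEN integrable_Re] L2_01D(2)[OF f] L2_01D(2)[OF g]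
    by (simp del: times_complex.simps times_complex.sel)
  also have "(LINT t|unit_lebesgue. Re (f t * cnj (g t))) = Re (L2_inner f g)"
    unfolding L2_inner_def by (rule integral_Re[OF L2_inner_integrable[OF f g]])
  finally show ?thesis .
qed

lemma L2_norm_triangle:
  assumes f: "f \<in> L2_01" and g: "g \<in> L2_01"
  shows "L2_norm (\<lambda>t. f t + g t) \<le> L2_norm f + L2_norm g"
proof (rule power2_le_imp_le)
  have "Re (L2_inner f g) \<le> L2_norm f * L2_norm g"
    using L2_Cauchy_Schwarz[OF f g] complex_Re_le_cmod order_trans by blast
  then show "(L2_norm (\<lambda>t. f t + g t))\<^sup>2 \<le> (L2_norm f + L2_norm g)\<^sup>2"
    by (simp add: L2_norm_add_power2[OF f g] power2_sum)
qed (simp add: L2_norm_nonneg)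

lemma L2_norm_triangle_diff:
  assumes "f \<in> L2_01" "g \<in> L2_01" "h \<in> L2_01"
  shows "L2_norm (\<lambda>t. f t - h t) \<le> L2_norm (\<lambda>t. f t - g t) + L2_norm (\<lambda>t. g t - h t)"
  using L2_norm_triangle[OF L2_01_diff[OF assms(1,2)] L2_01_diff[OF assms(2,3)]] by simp

lemma L2_norm_zero_iff_AE:
  assumes "f \<in> L2_01"
  shows "L2_norm f = 0 \<longleftrightarrow> (AE t in unit_lebesgue. f t = 0)"
  unfolding L2_norm_def
  using integral_nonneg_eq_0_iff_AE[OF L2_01D(2)[OF assms]] by simp

text \<open>The interval has measure one, so a uniform bound is also a bound in norm.\<close>

lemma L2_norm_bound:
  assumes f: "f \<in> borel_measurable unit_lebesgue" and B: "0 \<le> B"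
    and le: "\<And>t. t \<in> {0<..<1} \<Longrightarrow> cmod (f t) \<le> B"
  shows "f \<in> L2_01" "L2_norm f \<le> B"
proof -
  have sq: "(cmod (f t))\<^sup>2 \<le> B\<^sup>2" if "t \<in> {0<..<1}" for t
    using le[OF that] by (intro power_mono) auto
  have m: "emeasure unit_lebesgue (space unit_lebesgue) = 1"
    by (simp add: emeasure_restrict_space)
  interpret finite_measure unit_lebesgue
    by (rule finite_measureI) (use m in simp)
  have int: "integrable unit_lebesgue (\<lambda>t. (cmod (f t))\<^sup>2)"
    using f sq by (intro integrable_const_bound[of _ "B\<^sup>2"]) auto
  show "f \<in> L2_01" using f int by (simp add: L2_01_def)
  have "(LINT t|unit_lebesgue. (cmod (f t))\<^sup>2) \<le> (LINT t|unit_lebesgue. B\<^sup>2)"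
    using int sq by (intro integral_mono) auto
  also have "\<dots> = B\<^sup>2"
    using m by (simp add: measure_def)
  finally show "L2_norm f \<le> B"
    unfolding L2_norm_def using B real_le_lsqrt by (simp add: real_le_lsqrt)
qed

section \<open>Fatou's lemma and completeness\<close>

text \<open>Fatou's lemma for the squared moduli. A bound from the index \<open>n\<close> on
  suffices, since limits ignore finitely many members.\<close>

lemma L2_norm_Fatou:
  assumes f: "\<And>m. f m \<in> L2_01" and g: "g \<in> borel_measurable unit_lebesgue"
    and lim: "AE t in unit_lebesgue. (\<lambda>m. f m t) \<longlonglongrightarrow> g t"
    and le: "\<And>m. n \<le> m \<Longrightarrow> L2_norm (f m) \<le> B"
  shows "g \<in> L2_01" "L2_norm g \<le> B"
proof -
  have B: "0 \<le> B" using le[of n] L2_norm_nonneg order_trans by blast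
  note [measurable] = L2_01D(1)[OF f] g
  have "(\<integral>\<^sup>+t. ennreal ((cmod (g t))\<^sup>2) \<partial>unit_lebesgue) =
      (\<integral>\<^sup>+t. liminf (\<lambda>m. ennreal ((cmod (f m t))\<^sup>2)) \<partial>unit_lebesgue)"
  proof (rule nn_integral_cong_AE, use lim in eventually_elim)
    case (elim t)
    have "(\<lambda>m. ennreal ((cmod (f m t))\<^sup>2)) \<longlonglongrightarrow> ennreal ((cmod (g t))\<^sup>2)"
      using elim by (intro tendsto_ennrealI tendsto_intros)
    then show ?case
      by (intro lim_imp_Liminf[symmetric]) auto
  qed
  also have "\<dots> \<le> liminf (\<lambda>m. \<integral>\<^sup>+t. ennreal ((cmod (f m t))\<^sup>2) \<partial>unit_lebesgue)"
    by (intro nn_integral_liminf) measurable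
  also have "\<dots> \<le> limsup (\<lambda>m. \<integral>\<^sup>+t. ennreal ((cmod (f m t))\<^sup>2) \<partial>unit_lebesgue)"
    by (intro Liminf_le_Limsup) simp
  also have "\<dots> \<le> ennreal (B\<^sup>2)"
  proof (intro Limsup_bounded eventually_sequentiallyI[of n])
    fix m assume "n \<le> m"
    have "(\<integral>\<^sup>+t. ennreal ((cmod (f m t))\<^sup>2) \<partial>unit_lebesgue) = ennreal ((L2_norm (f m))\<^sup>2)"
      unfolding L2_norm_power2 by (rule nn_integral_eq_integral[OF L2_01D(2)[OF f]]) simp
    also have "\<dots> \<le> ennreal (B\<^sup>2)"
      using le[OF \<open>n \<le> m\<close>] L2_norm_nonneg by (intro ennreal_leI power_mono)
    finally show "(\<integral>\<^sup>+t. ennreal ((cmod (f m t))\<^sup>2) \<partial>unit_lebesgue) \<le> ennreal (B\<^sup>2)" .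
  qed
  finally have *: "(\<integral>\<^sup>+t. ennreal ((cmod (g t))\<^sup>2) \<partial>unit_lebesgue) \<le> ennreal (B\<^sup>2)" .
  have "integrable unit_lebesgue (\<lambda>t. (cmod (g t))\<^sup>2)"
    unfolding integrable_iff_bounded using * by (auto intro: le_less_trans)
  then show "g \<in> L2_01" using g by (simp add: L2_01_def)
  have "(L2_norm g)\<^sup>2 = enn2real (\<integral>\<^sup>+t. ennreal ((cmod (g t))\<^sup>2) \<partial>unit_lebesgue)"
    unfolding L2_norm_power2 by (rule integral_eq_nn_integral) auto
  also have "\<dots> \<le> enn2real (ennreal (B\<^sup>2))"
    using * by (intro enn2real_mono) auto
  finally have "(L2_norm g)\<^sup>2 \<le> B\<^sup>2" by simp
  then show "L2_norm g \<le> B" using B by (rule power2_le_imp_le)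
qed

lemma L2_norm_sum_le:
  assumes "\<And>i. i \<in> I \<Longrightarrow> f i \<in> L2_01"
  shows "L2_norm (\<lambda>t. \<Sum>i\<in>I. f i t) \<le> (\<Sum>i\<in>I. L2_norm (f i))"
  using assms
proof (induction I rule: infinite_finite_induct)
  case (insert i I)
  have "L2_norm (\<lambda>t. f i t + (\<Sum>i\<in>I. f i t)) \<le> L2_norm (f i) + L2_norm (\<lambda>t. \<Sum>i\<in>I. f i t)"
    using insert.prems by (intro L2_norm_triangle L2_01_sum) auto
  then show ?case using insert by force
qed (simp_all add: L2_norm_def)

text \<open>Cauchy-Schwarz against the constant \<open>1\<close> bounds the L1 norm by the L2 norm,
  so the sum of the moduli has a finite integral and is finite almost everywhere.\<close>

lemma AE_summable_L2:
  assumes v: "\<And>k. v k \<in> L2_01" and sm: "summable (\<lambda>k. L2_norm (v k))"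
  shows "AE t in unit_lebesgue. summable (\<lambda>k. cmod (v k t))"
proof -
  note [measurable] = L2_01D(1)[OF v]
  have one: "(\<lambda>t. 1) \<in> L2_01" "L2_norm (\<lambda>t. 1) \<le> 1"
    using L2_norm_bound[of "\<lambda>t. 1" 1] by auto
  have le: "(\<integral>\<^sup>+t. ennreal (cmod (v k t)) \<partial>unit_lebesgue) \<le> ennreal (L2_norm (v k))" for k
  proof -
    have "integrable unit_lebesgue (\<lambda>t. cmod (v k t))"
      using integrable_norm[OF L2_inner_integrable[OF v one(1)]] by simp
    then have "(\<integral>\<^sup>+t. ennreal (cmod (v k t)) \<partial>unit_lebesgue) = ennreal (LINT t|unit_lebesgue. cmod (v k t))"
      by (rule nn_integral_eq_integral) simp
    also have "\<dots> \<le> ennreal (L2_norm (v k) * L2_norm (\<lambda>t. 1))"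
      using L2_Cauchy_Schwarz_abs[OF v one(1)] by (intro ennreal_leI) simp
    also have "\<dots> \<le> ennreal (L2_norm (v k))"
      using one(2) L2_norm_nonneg by (intro ennreal_leI) (simp add: mult_left_le)
    finally show ?thesis .
  qed
  have "(\<integral>\<^sup>+t. (\<Sum>k. ennreal (cmod (v k t))) \<partial>unit_lebesgue) = (\<Sum>k. \<integral>\<^sup>+t. ennreal (cmod (v k t)) \<partial>unit_lebesgue)"
    by (rule nn_integral_suminf) measurable
  also have "\<dots> \<le> (\<Sum>k. ennreal (L2_norm (v k)))"
    by (intro suminf_le le summableI)
  also have "\<dots> < \<infinity>"
    using ennreal_suminf_neq_top[OF sm L2_norm_nonneg] by (simp only: less_top infinity_ennreal_def)
  finally have "AE t in unit_lebesgue. (\<Sum>k. ennreal (cmod (v k t))) \<noteq> \<infinity>"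
    by (intro nn_integral_PInf_AE) (auto simp: less_top[symmetric])
  then show ?thesis
    by eventually_elim (rule summable_suminf_not_top, auto)
qed

text \<open>Riesz-Fischer for absolutely convergent series: the partial sums converge pointwise
  almost everywhere, and Fatou turns their Cauchy estimate into a norm estimate for the
  limit.\<close>

lemma L2_complete:
  assumes v: "\<And>k. v k \<in> L2_01" and sm: "summable (\<lambda>k. L2_norm (v k))"
  shows "\<exists>u\<in>L2_01. (\<lambda>n. L2_norm (\<lambda>t. u t - (\<Sum>k<n. v k t))) \<longlonglongrightarrow> 0"
proof -
  note [measurable] = L2_01D(1)[OF v]
  \<comment> \<open>Where the series diverges, \<open>u t\<close> is an unspecified value; such
    points form a null set by \<open>AE_summable_L2\<close>.\<close>
  define u where "u t = (\<Sum>k. v k t)" for t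
  define s where "s n t = (\<Sum>k<n. v k t)" for n t
  \<comment> \<open>\<open>T n\<close> is the tail of the series of norms. It bounds the norm of
    \<open>s m - s n\<close> for all \<open>m \<ge> n\<close> at once, as Fatou requires.\<close>
  define T where "T n = (\<Sum>k. L2_norm (v k)) - (\<Sum>k<n. L2_norm (v k))" for n
  have [measurable]: "u \<in> borel_measurable unit_lebesgue" "s n \<in> borel_measurable unit_lebesgue" for n
    unfolding u_def s_def by measurable
  have s: "s n \<in> L2_01" for n
    unfolding s_def by (intro L2_01_sum v)
  have lim: "AE t in unit_lebesgue. (\<lambda>m. s m t) \<longlonglongrightarrow> u t"
    using AE_summable_L2[OF v sm]
  proof eventually_elim
    case (elim t)
    then show ?case
      unfolding s_def u_def by (rule summable_LIMSEQ[OF summable_norm_cancel])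
  qed
  have le: "L2_norm (\<lambda>t. s m t - s n t) \<le> T n" if "n \<le> m" for m n
  proof -
    have "(\<lambda>t. s m t - s n t) = (\<lambda>t. \<Sum>k\<in>{n..<m}. v k t)"
      unfolding s_def using that by (auto simp: lessThan_atLeast0 sum_diff_nat_ivl)
    then have "L2_norm (\<lambda>t. s m t - s n t) \<le> (\<Sum>k\<in>{n..<m}. L2_norm (v k))"
      using L2_norm_sum_le[of "{n..<m}" v] v by simp
    also have "\<dots> = (\<Sum>k<m. L2_norm (v k)) - (\<Sum>k<n. L2_norm (v k))"
      using that sum_diff_nat_ivl[of 0 n m "\<lambda>k. L2_norm (v k)"] by (simp add: lessThan_atLeast0)
    also have "\<dots> \<le> T n"
      unfolding T_def using sm L2_norm_nonneg by (intro diff_right_mono sum_le_suminf) auto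
    finally show ?thesis .
  qed
  have lim': "AE t in unit_lebesgue. (\<lambda>m. s m t - s n t) \<longlonglongrightarrow> u t - s n t" for n
    using lim by eventually_elim (intro tendsto_intros)
  have us: "(\<lambda>t. u t - s n t) \<in> L2_01" "L2_norm (\<lambda>t. u t - s n t) \<le> T n" for n
  proof -
    have "(\<lambda>t. u t - s n t) \<in> borel_measurable unit_lebesgue" by measurable
    from L2_norm_Fatou[where n = n, OF L2_01_diff[OF s s] this lim' le]
    show "(\<lambda>t. u t - s n t) \<in> L2_01" "L2_norm (\<lambda>t. u t - s n t) \<le> T n" by simp_all
  qed
  have u: "u \<in> L2_01"
    using us(1)[of 0] by (simp add: s_def)
  have "T \<longlonglongrightarrow> (\<Sum>k. L2_norm (v k)) - (\<Sum>k. L2_norm (v k))"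
    unfolding T_def by (intro tendsto_diff tendsto_const summable_LIMSEQ sm)
  then have T0: "T \<longlonglongrightarrow> 0" by simp
  have "(\<lambda>n. L2_norm (\<lambda>t. u t - s n t)) \<longlonglongrightarrow> 0"
  proof (rule Lim_null_comparison[OF always_eventually T0], rule allI)
    show "norm (L2_norm (\<lambda>t. u t - s n t)) \<le> T n" for n
      using us(2)[of n] L2_norm_nonneg[of "\<lambda>t. u t - s n t"] by simp
  qed
  with u show ?thesis unfolding s_def by blast
qed

section \<open>Pointwise comparison and dilations\<close>

lemma L2_norm_mono:
  assumes f: "f \<in> borel_measurable unit_lebesgue" and g: "g \<in> L2_01"
    and le: "\<And>t. cmod (f t) \<le> cmod (g t)"
  shows "f \<in> L2_01" "L2_norm f \<le> L2_norm g"
proof -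
  have sq: "(cmod (f t))\<^sup>2 \<le> (cmod (g t))\<^sup>2" for t
    using le by (intro power_mono) auto
  show fL: "f \<in> L2_01" using L2_01_bound[OF f L2_01D(2)[OF g] sq] .
  show "L2_norm f \<le> L2_norm g"
    unfolding L2_norm_def
    by (intro real_sqrt_le_mono integral_mono L2_01D(2) fL g sq)
qed

lemma borel_measurable_unit_lebesgue:
  "f \<in> borel_measurable borel \<Longrightarrow> f \<in> borel_measurable unit_lebesgue"
  by (intro measurable_restrict_space1 measurable_completion) simp

text \<open>The substitution \<open>u = s * t\<close> maps the interval into itself and costs a
  factor \<open>s\<close> in the squared norm.\<close>

lemma L2_norm_dilation_le:
  assumes G: "G \<in> L2_01" and s: "0 < s" "s \<le> 1"
  shows "(\<lambda>t. G (s * t)) \<in> L2_01" "sqrt s * L2_norm (\<lambda>t. G (s * t)) \<le> L2_norm G"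
proof -
  \<comment> \<open>Truncation allows the substitution on the whole line, whatever the values of
    \<open>G\<close> outside the interval.\<close>
  define H where "H t = (if t \<in> {0<..<1} then G t else 0)" for t :: real
  have [measurable]: "H \<in> borel_measurable lebesgue"
    unfolding H_def using L2_01D(1)[OF G] by (subst borel_measurable_if) auto
  have "(*\<^sub>R) s = (\<lambda>t. s * t)" by (simp add: fun_eq_iff)
  then have "(\<lambda>t. s * t) \<in> lebesgue \<rightarrow>\<^sub>M lebesgue"
    using lebesgue_measurable_scaling[of s] by metis
  then have [measurable]: "(\<lambda>t. H (s * t)) \<in> borel_measurable lebesgue"
    by (rule measurable_compose) measurable
  have Hs: "H (s * t) = G (s * t)" if "t \<in> {0<..<1}" for t
  proof -
    have "s * t \<le> 1 * t" using that s by (intro mult_right_mono) auto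
    also have "1 * t < 1" using that by simp
    finally have "s * t < 1" .
    then show ?thesis using that s by (simp add: H_def)
  qed
  have meas: "(\<lambda>t. G (s * t)) \<in> borel_measurable unit_lebesgue"
  proof -
    have "(\<lambda>t. H (s * t)) \<in> borel_measurable unit_lebesgue"
      by (rule measurable_restrict_space1) measurable
    then show ?thesis
      using Hs by (subst measurable_cong[of _ _ "\<lambda>t. H (s * t)"]) auto
  qed
  have nn: "(\<integral>\<^sup>+t. ennreal ((cmod (F t))\<^sup>2) \<partial>unit_lebesgue) =
      (\<integral>\<^sup>+t. ennreal ((cmod (F t))\<^sup>2) * indicator {0<..<1} t \<partial>lebesgue)" for F :: "real \<Rightarrow> complex"
    by (rule nn_integral_restrict_space) simp
  have "ennreal s * (\<integral>\<^sup>+t. ennreal ((cmod (G (s * t)))\<^sup>2) \<partial>unit_lebesgue) =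
      ennreal s * (\<integral>\<^sup>+t. ennreal ((cmod (G (s * t)))\<^sup>2) * indicator {0<..<1} t \<partial>lebesgue)"
    by (simp add: nn)
  \<comment> \<open>Integrating over the whole line adds the contribution of
    \<open>1 \<le> t < 1 / s\<close>; here equality is lost.\<close>
  also have "\<dots> \<le> ennreal s * (\<integral>\<^sup>+t. ennreal ((cmod (H (s * t)))\<^sup>2) \<partial>lebesgue)"
    using Hs by (intro mult_left_mono nn_integral_mono) (auto simp: indicator_def)
  also have "\<dots> = (\<integral>\<^sup>+t. ennreal ((cmod (H t))\<^sup>2) \<partial>lebesgue)"
    using s nn_integral_real_affine_lebesgue[of "\<lambda>t. ennreal ((cmod (H t))\<^sup>2)" s 0] by simp
  also have "\<dots> = (\<integral>\<^sup>+t. ennreal ((cmod (G t))\<^sup>2) * indicator {0<..<1} t \<partial>lebesgue)"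
    by (intro nn_integral_cong) (auto simp: H_def indicator_def)
  also have "\<dots> = ennreal ((L2_norm G)\<^sup>2)"
    unfolding nn[symmetric] L2_norm_power2 by (rule nn_integral_eq_integral[OF L2_01D(2)[OF G]]) simp
  finally have le: "ennreal s * (\<integral>\<^sup>+t. ennreal ((cmod (G (s * t)))\<^sup>2) \<partial>unit_lebesgue) \<le> ennreal ((L2_norm G)\<^sup>2)" .
  then have "(\<integral>\<^sup>+t. ennreal ((cmod (G (s * t)))\<^sup>2) \<partial>unit_lebesgue) \<noteq> \<infinity>"
    using s by (auto simp: ennreal_mult_top top_unique)
  then have int: "integrable unit_lebesgue (\<lambda>t. (cmod (G (s * t)))\<^sup>2)"
    unfolding integrable_iff_bounded using meas by (auto simp: less_top)
  then show "(\<lambda>t. G (s * t)) \<in> L2_01"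
    using meas by (simp add: L2_01_def)
  have "(\<integral>\<^sup>+t. ennreal ((cmod (G (s * t)))\<^sup>2) \<partial>unit_lebesgue) = ennreal ((L2_norm (\<lambda>t. G (s * t)))\<^sup>2)"
    unfolding L2_norm_power2 by (rule nn_integral_eq_integral[OF int]) simp
  with le have "s * (L2_norm (\<lambda>t. G (s * t)))\<^sup>2 \<le> (L2_norm G)\<^sup>2"
    using s by (simp add: ennreal_mult[symmetric])
  then have "(sqrt s * L2_norm (\<lambda>t. G (s * t)))\<^sup>2 \<le> (L2_norm G)\<^sup>2"
    using s by (simp add: power_mult_distrib)
  then show "sqrt s * L2_norm (\<lambda>t. G (s * t)) \<le> L2_norm G"
    using L2_norm_nonneg by (rule power2_le_imp_le)
qed

section \<open>Closed spans and orthogonal projection\<close>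

lemma complex_span_add:
  assumes "f \<in> complex_span S" "g \<in> complex_span S"
  shows "(\<lambda>t. f t + g t) \<in> complex_span S"
proof -
  obtain T c where T: "finite T" "T \<subseteq> S" "f = (\<lambda>t. \<Sum>h\<in>T. c h * h t)"
    using assms(1) by (auto simp: complex_span_def)
  obtain U d where U: "finite U" "U \<subseteq> S" "g = (\<lambda>t. \<Sum>h\<in>U. d h * h t)"
    using assms(2) by (auto simp: complex_span_def)
  define e where "e h = (if h \<in> T then c h else 0) + (if h \<in> U then d h else 0)" for h
  have "f t + g t = (\<Sum>h\<in>T \<union> U. e h * h t)" for t
  proof -
    have "(\<Sum>h\<in>T \<union> U. e h * h t) = (\<Sum>h\<in>T \<union> U. (if h \<in> T then c h else 0) * h t) +
        (\<Sum>h\<in>T \<union> U. (if h \<in> U then d h else 0) * h t)"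
      by (simp add: e_def distrib_right sum.distrib)
    also have "(\<Sum>h\<in>T \<union> U. (if h \<in> T then c h else 0) * h t) = f t"
      unfolding T(3) using T(1) U(1) by (intro sum.mono_neutral_cong_right) auto
    also have "(\<Sum>h\<in>T \<union> U. (if h \<in> U then d h else 0) * h t) = g t"
      unfolding U(3) using T(1) U(1) by (intro sum.mono_neutral_cong_right) auto
    finally show ?thesis by simp
  qed
  then show ?thesis
    unfolding complex_span_def using T U by (intro CollectI exI[of _ "T \<union> U"] exI[of _ e]) auto
qed

lemma complex_span_scale:
  assumes "f \<in> complex_span S"
  shows "(\<lambda>t. a * f t) \<in> complex_span S"
proof -
  obtain T c where T: "finite T" "T \<subseteq> S" "f = (\<lambda>t. \<Sum>h\<in>T. c h * h t)"
    using assms by (auto simp: complex_span_def)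
  show ?thesis
    unfolding complex_span_def
    by (intro CollectI exI[of _ T] exI[of _ "\<lambda>h. a * c h"]) (use T in \<open>auto simp: sum_distrib_left mult.assoc\<close>)
qed

lemma complex_span_superset: "S \<subseteq> complex_span S"
proof
  fix h assume "h \<in> S"
  then show "h \<in> complex_span S"
    unfolding complex_span_def by (intro CollectI exI[of _ "{h}"] exI[of _ "\<lambda>_. 1"]) auto
qed

lemma complex_span_zero: "(\<lambda>t. 0) \<in> complex_span S"
  unfolding complex_span_def by (intro CollectI exI[of _ "{}"]) auto

lemma complex_span_sum:
  assumes "\<And>i. i \<in> I \<Longrightarrow> f i \<in> complex_span S"
  shows "(\<lambda>t. \<Sum>i\<in>I. f i t) \<in> complex_span S"
  using assms
  by (induction I rule: infinite_finite_induct) (auto intro: complex_span_zero complex_span_add)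

lemma complex_span_L2:
  assumes "S \<subseteq> L2_01" "f \<in> complex_span S"
  shows "f \<in> L2_01"
  using assms by (auto simp: complex_span_def intro!: L2_01_sum L2_01_scale)

text \<open>\<open>complex_span\<close> sums over functions, whereas coefficient estimates need sums
  over indices. Choosing one index for each function makes the two agree.\<close>

lemma complex_span_image_obtains:
  assumes "f \<in> complex_span (x ` I)"
  obtains J c where "finite J" "J \<subseteq> I" "f = (\<lambda>t. \<Sum>k\<in>J. c k * x k t)"
proof -
  obtain T d where T: "finite T" "T \<subseteq> x ` I" "f = (\<lambda>t. \<Sum>h\<in>T. d h * h t)"
    using assms by (auto simp: complex_span_def)
  obtain J where J: "J \<subseteq> I" "inj_on x J" "T = x ` J"
    using T(2) by (auto simp: subset_image_inj)
  show thesis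
  proof (rule that)
    show "finite J" using T(1) J finite_image_iff by blast
    show "f = (\<lambda>t. \<Sum>k\<in>J. d (x k) * x k t)"
      unfolding T(3) J(3) by (simp add: sum.reindex[OF J(2)])
  qed (rule J(1))
qed

lemma closed_span_L2: "f \<in> closed_span S \<Longrightarrow> f \<in> L2_01"
  by (simp add: closed_span_def)

lemma closed_span_approx:
  assumes "f \<in> closed_span S" "0 < \<epsilon>"
  obtains g where "g \<in> complex_span S" "L2_norm (\<lambda>t. f t - g t) < \<epsilon>"
  using assms by (auto simp: closed_span_def)

lemma complex_span_subset_closed_span:
  assumes "S \<subseteq> L2_01"
  shows "complex_span S \<subseteq> closed_span S"
proof
  fix f assume f: "f \<in> complex_span S"
  have "L2_norm (\<lambda>t. f t - f t) = 0" by (simp add: L2_norm_def)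
  then show "f \<in> closed_span S"
    unfolding closed_span_def using f complex_span_L2[OF assms f] by force
qed

lemma closed_span_superset: "S \<subseteq> L2_01 \<Longrightarrow> S \<subseteq> closed_span S"
  using complex_span_superset complex_span_subset_closed_span by blast

lemma closed_span_closed:
  assumes S: "S \<subseteq> L2_01" and f: "f \<in> L2_01"
    and appr: "\<And>\<epsilon>. 0 < \<epsilon> \<Longrightarrow> \<exists>g\<in>closed_span S. L2_norm (\<lambda>t. f t - g t) < \<epsilon>"
  shows "f \<in> closed_span S"
  unfolding closed_span_def
proof (safe intro!: f)
  fix \<epsilon> :: real assume "0 < \<epsilon>"
  then obtain g where g: "g \<in> closed_span S" "L2_norm (\<lambda>t. f t - g t) < \<epsilon> / 2"
    using appr[of "\<epsilon> / 2"] by auto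
  obtain h where h: "h \<in> complex_span S" "L2_norm (\<lambda>t. g t - h t) < \<epsilon> / 2"
    using closed_span_approx[OF g(1), of "\<epsilon> / 2"] \<open>0 < \<epsilon>\<close> by auto
  have "L2_norm (\<lambda>t. f t - h t) < \<epsilon>"
    using L2_norm_triangle_diff[OF f closed_span_L2[OF g(1)] complex_span_L2[OF S h(1)]] g h by linarith
  with h show "\<exists>g\<in>complex_span S. L2_norm (\<lambda>t. f t - g t) < \<epsilon>" by blast
qed

text \<open>Functions that agree almost everywhere are at distance zero, so closedness
  applies.\<close>

lemma closed_span_cong_AE:
  assumes S: "S \<subseteq> L2_01" and f: "f \<in> closed_span S" and ae: "AE t in unit_lebesgue. f t = g t"
  shows "g \<in> closed_span S"
proof (rule closed_span_closed[OF S])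
  show g: "g \<in> L2_01" using L2_01_cong_AE[OF closed_span_L2[OF f] ae] .
  have "L2_norm (\<lambda>t. g t - f t) = 0"
    using L2_norm_zero_iff_AE[OF L2_01_diff[OF g closed_span_L2[OF f]]] ae
    by (auto elim: eventually_mono)
  then show "\<exists>h\<in>closed_span S. L2_norm (\<lambda>t. g t - h t) < \<epsilon>" if "0 < \<epsilon>" for \<epsilon>
    using that by (intro bexI[OF _ f]) simp
qed

lemma closed_span_add:
  assumes S: "S \<subseteq> L2_01" and f: "f \<in> closed_span S" and g: "g \<in> closed_span S"
  shows "(\<lambda>t. f t + g t) \<in> closed_span S"
  unfolding closed_span_def
proof (safe intro!: L2_01_add closed_span_L2[OF f] closed_span_L2[OF g])
  fix \<epsilon> :: real assume "0 < \<epsilon>"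
  then have e: "0 < \<epsilon> / 2" by simp
  obtain u where u: "u \<in> complex_span S" "L2_norm (\<lambda>t. f t - u t) < \<epsilon> / 2"
    using closed_span_approx[OF f e] .
  obtain v where v: "v \<in> complex_span S" "L2_norm (\<lambda>t. g t - v t) < \<epsilon> / 2"
    using closed_span_approx[OF g e] .
  have "L2_norm (\<lambda>t. (f t - u t) + (g t - v t)) < \<epsilon>"
    using L2_norm_triangle[OF L2_01_diff[OF closed_span_L2[OF f] complex_span_L2[OF S u(1)]]
        L2_01_diff[OF closed_span_L2[OF g] complex_span_L2[OF S v(1)]]] u v by linarith
  then have "L2_norm (\<lambda>t. (f t + g t) - (u t + v t)) < \<epsilon>"
    by (simp add: algebra_simps)
  then show "\<exists>h\<in>complex_span S. L2_norm (\<lambda>t. f t + g t - h t) < \<epsilon>"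
    by (rule bexI[OF _ complex_span_add[OF u(1) v(1)]])
qed

lemma closed_span_scale:
  assumes S: "S \<subseteq> L2_01" and f: "f \<in> closed_span S"
  shows "(\<lambda>t. c * f t) \<in> closed_span S"
  unfolding closed_span_def
proof (safe intro!: L2_01_scale closed_span_L2[OF f])
  fix \<epsilon> :: real assume "0 < \<epsilon>"
  \<comment> \<open>The summand \<open>1\<close> covers the case \<open>c = 0\<close>.\<close>
  then have e: "0 < \<epsilon> / (cmod c + 1)" by (simp add: add_nonneg_pos)
  obtain u where u: "u \<in> complex_span S" "L2_norm (\<lambda>t. f t - u t) < \<epsilon> / (cmod c + 1)"
    using closed_span_approx[OF f e] .
  have "L2_norm (\<lambda>t. c * f t - c * u t) = cmod c * L2_norm (\<lambda>t. f t - u t)"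
    by (simp flip: right_diff_distrib add: L2_norm_scale)
  also have "\<dots> \<le> (cmod c + 1) * L2_norm (\<lambda>t. f t - u t)"
    using L2_norm_nonneg by (intro mult_right_mono) auto
  also have "\<dots> < \<epsilon>"
    using u(2) by (subst mult.commute, subst (asm) pos_less_divide_eq) (simp_all add: add_nonneg_pos)
  finally show "\<exists>h\<in>complex_span S. L2_norm (\<lambda>t. c * f t - h t) < \<epsilon>"
    by (rule bexI[OF _ complex_span_scale[OF u(1)]])
qed

lemma closed_span_diff:
  assumes "S \<subseteq> L2_01" "f \<in> closed_span S" "g \<in> closed_span S"
  shows "(\<lambda>t. f t - g t) \<in> closed_span S"
  using closed_span_add[OF assms(1,2) closed_span_scale[OF assms(1,3), of "-1"]] by simp

lemma closed_span_minimal: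
  assumes S: "S \<subseteq> closed_span T" and T: "T \<subseteq> L2_01"
  shows "closed_span S \<subseteq> closed_span T"
proof
  fix f assume f: "f \<in> closed_span S"
  have span: "complex_span S \<subseteq> closed_span T"
  proof
    fix g assume "g \<in> complex_span S"
    then obtain U c where U: "finite U" "U \<subseteq> S" "g = (\<lambda>t. \<Sum>h\<in>U. c h * h t)"
      by (auto simp: complex_span_def)
    have "(\<lambda>t. \<Sum>h\<in>U. c h * h t) \<in> closed_span T"
      using U(1,2)
    proof (induction U)
      case empty
      then show ?case
        using complex_span_zero complex_span_subset_closed_span[OF T] by auto
    next
      case (insert h U)
      then show ?case
        using S by (auto intro!: closed_span_add closed_span_scale T)
    qed
    with U(3) show "g \<in> closed_span T" by simp
  qed
  show "f \<in> closed_span T"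
  proof (rule closed_span_closed[OF T closed_span_L2[OF f]])
    show "\<exists>g\<in>closed_span T. L2_norm (\<lambda>t. f t - g t) < \<epsilon>" if "0 < \<epsilon>" for \<epsilon>
      using closed_span_approx[OF f that] span by blast
  qed
qed

text \<open>The inner product with \<open>h\<close> vanishes on the span and is continuous by
  Cauchy-Schwarz.\<close>

lemma closed_span_orthogonal:
  assumes S: "S \<subseteq> L2_01" and f: "f \<in> closed_span S" and h: "h \<in> L2_01"
    and orth: "\<And>s. s \<in> S \<Longrightarrow> L2_inner s h = 0"
  shows "L2_inner f h = 0"
proof -
  have "cmod (L2_inner f h) \<le> 0"
  proof (rule field_le_epsilon)
    fix e :: real assume "0 < e"
    then have e: "0 < e / (L2_norm h + 1)" using L2_norm_nonneg by (simp add: add_nonneg_pos)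
    obtain g where g: "g \<in> complex_span S" "L2_norm (\<lambda>t. f t - g t) < e / (L2_norm h + 1)"
      using closed_span_approx[OF f e] .
    note L2 = closed_span_L2[OF f] complex_span_L2[OF S g(1)]
    obtain T c where T: "finite T" "T \<subseteq> S" "g = (\<lambda>t. \<Sum>h\<in>T. c h * h t)"
      using g(1) by (auto simp: complex_span_def)
    have "L2_inner g h = (\<Sum>s\<in>T. c s * L2_inner s h)"
      unfolding T(3) using T(2) S h by (intro L2_inner_sum_left) auto
    also have "\<dots> = 0" using T(2) orth by (intro sum.neutral) auto
    finally have "L2_inner f h = L2_inner (\<lambda>t. f t - g t) h"
      using L2 h by (simp add: L2_inner_diff_left)
    then have "cmod (L2_inner f h) \<le> L2_norm (\<lambda>t. f t - g t) * L2_norm h"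
      using L2_Cauchy_Schwarz[OF L2_01_diff[OF L2] h] by simp
    also have "\<dots> \<le> L2_norm (\<lambda>t. f t - g t) * (L2_norm h + 1)"
      using L2_norm_nonneg by (intro mult_left_mono) auto
    also have "\<dots> \<le> e"
      using g(2) L2_norm_nonneg[of h] by (simp add: field_simps add_nonneg_pos)
    finally show "cmod (L2_inner f h) \<le> 0 + e" by simp
  qed
  then show ?thesis by simp
qed

section \<open>Orthogonal projection onto a closed span\<close>

lemma L2_parallelogram:
  assumes "f \<in> L2_01" "g \<in> L2_01"
  shows "(L2_norm (\<lambda>t. f t - g t))\<^sup>2 + (L2_norm (\<lambda>t. f t + g t))\<^sup>2 = 2 * (L2_norm f)\<^sup>2 + 2 * (L2_norm g)\<^sup>2"
proof -
  have "(\<lambda>t. f t - g t) = (\<lambda>t. f t + (-1) * g t)" by simp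
  then have "(L2_norm (\<lambda>t. f t - g t))\<^sup>2 = (L2_norm f)\<^sup>2 + 2 * Re (L2_inner f (\<lambda>t. (-1) * g t)) + (L2_norm (\<lambda>t. (-1) * g t))\<^sup>2"
    using L2_norm_add_power2[OF assms(1) L2_01_scale[OF assms(2), of "-1"]] by simp
  moreover have "Re (L2_inner f (\<lambda>t. (-1) * g t)) = - Re (L2_inner f g)"
    by (subst L2_inner_commute, subst L2_inner_scale_left, subst L2_inner_commute) simp
  moreover have "L2_norm (\<lambda>t. (-1) * g t) = L2_norm g"
    by (subst L2_norm_scale) simp
  ultimately show ?thesis
    using L2_norm_add_power2[OF assms] by simp
qed

text \<open>A minimizing sequence for the distance is chosen in the algebraic span. Midpoints stay
  in the span, so the parallelogram law makes the sequence Cauchy, and varying it in the direction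
  of \<open>h\<close> gives orthogonality in the limit.\<close>

lemma L2_projection:
  assumes S: "S \<subseteq> L2_01" and f: "f \<in> L2_01"
  shows "\<exists>g\<in>closed_span S. \<forall>h\<in>S. L2_inner (\<lambda>t. f t - g t) h = 0"
proof -
  define A where "A = (\<lambda>g. (L2_norm (\<lambda>t. f t - g t))\<^sup>2) ` complex_span S"
  define d where "d = Inf A"
  have A: "A \<noteq> {}" "bdd_below A"
    using complex_span_zero unfolding A_def by (auto intro!: bdd_belowI[of _ 0])
  have d: "d \<le> (L2_norm (\<lambda>t. f t - g t))\<^sup>2" if "g \<in> complex_span S" for g
    unfolding d_def using that A by (intro cInf_lower) (auto simp: A_def)
  \<comment> \<open>The rate \<open>(1/4)^n\<close> makes the norms of the increments
    \<open>O((1/2)^n)\<close>, hence summable, which is the form of convergence that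
    \<open>L2_complete\<close> asks for.\<close>
  have "\<exists>g\<in>complex_span S. (L2_norm (\<lambda>t. f t - g t))\<^sup>2 < d + (1/4)^n" for n :: nat
    using cInf_lessD[OF A(1), of "d + (1/4)^n"] by (auto simp: A_def d_def)
  then obtain g where g: "\<And>n. g n \<in> complex_span S"
    and gd: "\<And>n. (L2_norm (\<lambda>t. f t - g n t))\<^sup>2 < d + (1/4)^n"
    by metis
  have gL: "g n \<in> L2_01" for n using complex_span_L2[OF S g] .
  have diff: "L2_norm (\<lambda>t. g (Suc n) t - g n t) \<le> 2 * (1/2)^n" for n
  proof (rule power2_le_imp_le)
    have "(\<lambda>t. (f t - g n t) - (f t - g (Suc n) t)) = (\<lambda>t. g (Suc n) t - g n t)"
      by auto
    moreover have "(\<lambda>t. (f t - g n t) + (f t - g (Suc n) t)) = (\<lambda>t. 2 * (f t - (1/2) * (g n t + g (Suc n) t)))"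
      by (auto simp: algebra_simps)
    moreover have "(L2_norm (\<lambda>t. 2 * (f t - (1/2) * (g n t + g (Suc n) t))))\<^sup>2 =
        4 * (L2_norm (\<lambda>t. f t - (1/2) * (g n t + g (Suc n) t)))\<^sup>2"
      by (subst L2_norm_scale) (simp add: power_mult_distrib)
    ultimately have "(L2_norm (\<lambda>t. g (Suc n) t - g n t))\<^sup>2 + 4 * (L2_norm (\<lambda>t. f t - (1/2) * (g n t + g (Suc n) t)))\<^sup>2
       = 2 * (L2_norm (\<lambda>t. f t - g n t))\<^sup>2 + 2 * (L2_norm (\<lambda>t. f t - g (Suc n) t))\<^sup>2"
      using L2_parallelogram[OF L2_01_diff[OF f gL[of n]] L2_01_diff[OF f gL[of "Suc n"]]]
      by (simp only:)
    moreover have "d \<le> (L2_norm (\<lambda>t. f t - (1/2) * (g n t + g (Suc n) t)))\<^sup>2"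
      by (intro d complex_span_scale complex_span_add g)
    ultimately have "(L2_norm (\<lambda>t. g (Suc n) t - g n t))\<^sup>2 \<le> 2 * (1/4)^n + 2 * (1/4)^Suc n"
      using gd[of n] gd[of "Suc n"] by linarith
    also have "\<dots> \<le> 4 * (1/4)^n" by simp
    also have "\<dots> = (2 * (1/2)^n)\<^sup>2"
      by (simp add: power_mult_distrib power2_eq_square flip: power_mult_distrib)
    finally show "(L2_norm (\<lambda>t. g (Suc n) t - g n t))\<^sup>2 \<le> (2 * (1/2)^n)\<^sup>2" .
  qed simp
  have "summable (\<lambda>n. L2_norm (\<lambda>t. g (Suc n) t - g n t))"
    by (rule summable_comparison_test'[of "\<lambda>n. 2 * (1/2)^n" 0])
       (use diff L2_norm_nonneg in \<open>auto intro!: summable_mult summable_geometric\<close>)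
  then obtain u where u: "u \<in> L2_01"
    and ul: "(\<lambda>n. L2_norm (\<lambda>t. u t - (\<Sum>k<n. g (Suc k) t - g k t))) \<longlonglongrightarrow> 0"
    using L2_complete[of "\<lambda>n t. g (Suc n) t - g n t"] L2_01_diff[OF gL gL] by blast
  \<comment> \<open>The increments telescope to \<open>g n - g 0\<close>, so \<open>g 0\<close> has
    to be added back.\<close>
  define p where "p t = u t + g 0 t" for t
  have pL: "p \<in> L2_01" unfolding p_def by (intro L2_01_add u gL)
  have lim: "(\<lambda>n. L2_norm (\<lambda>t. p t - g n t)) \<longlonglongrightarrow> 0"
  proof -
    have "u t - (\<Sum>k<n. g (Suc k) t - g k t) = p t - g n t" for n t
      using sum_lessThan_telescope[of "\<lambda>k. g k t" n] by (simp add: p_def)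
    with ul show ?thesis by simp
  qed
  have "p \<in> closed_span S"
    unfolding closed_span_def
  proof (safe intro!: pL)
    fix \<epsilon> :: real assume "0 < \<epsilon>"
    then have "eventually (\<lambda>n. L2_norm (\<lambda>t. p t - g n t) < \<epsilon>) sequentially"
      using order_tendstoD(2)[OF lim] by blast
    then show "\<exists>g\<in>complex_span S. L2_norm (\<lambda>t. p t - g t) < \<epsilon>"
      using g by (auto simp: eventually_sequentially)
  qed
  moreover have "L2_inner (\<lambda>t. f t - p t) h = 0" if h: "h \<in> S" for h
  proof -
    have hL: "h \<in> L2_01" using h S by auto
    have *: "cmod (L2_inner (\<lambda>t. f t - g n t) h) \<le> (1/2)^n * L2_norm h" for n
    proof (cases "L2_norm h = 0")
      case True
      then show ?thesis
        using L2_Cauchy_Schwarz[OF L2_01_diff[OF f gL[of n]] hL] by simp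
    next
      case False
      then have hp: "0 < L2_norm h" using L2_norm_nonneg[of h] by linarith
      let ?a = "\<lambda>t. f t - g n t"
      define z where "z = L2_inner ?a h"
      \<comment> \<open>\<open>c * h\<close> is minus the component of \<open>?a\<close> along
        \<open>h\<close>. Adding it lowers the squared norm by
        \<open>(cmod z)^2 / (L2_norm h)^2\<close>, and near-minimality of \<open>g n\<close> allows
        less than \<open>(1/4)^n\<close>.\<close>
      define c where "c = - z / complex_of_real ((L2_norm h)\<^sup>2)"
      have aL: "?a \<in> L2_01" by (intro L2_01_diff f gL)
      have "L2_inner ?a (\<lambda>t. c * h t) = cnj c * z"
        unfolding z_def by (subst L2_inner_commute, subst L2_inner_scale_left, subst L2_inner_commute) simp
      also have "\<dots> = - complex_of_real ((cmod z)\<^sup>2 / (L2_norm h)\<^sup>2)"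
        using complex_norm_square[of z] by (simp add: c_def mult.commute)
      finally have in1: "Re (L2_inner ?a (\<lambda>t. c * h t)) = - ((cmod z)\<^sup>2 / (L2_norm h)\<^sup>2)" by simp
      have in2: "(L2_norm (\<lambda>t. c * h t))\<^sup>2 = (cmod z)\<^sup>2 / (L2_norm h)\<^sup>2"
      proof -
        have "cmod c = cmod z / (L2_norm h)\<^sup>2"
          by (simp add: c_def norm_divide norm_power)
        then show ?thesis
          unfolding L2_norm_scale using hp by (simp add: field_simps power2_eq_square)
      qed
      have "(\<lambda>t. ?a t + c * h t) = (\<lambda>t. f t - (g n t + (- c) * h t))" by auto
      moreover have "(\<lambda>t. g n t + (- c) * h t) \<in> complex_span S"
        using h complex_span_superset by (intro complex_span_add complex_span_scale g) auto
      ultimately have "d \<le> (L2_norm (\<lambda>t. ?a t + c * h t))\<^sup>2"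
        using d by simp
      also have "\<dots> = (L2_norm ?a)\<^sup>2 - (cmod z)\<^sup>2 / (L2_norm h)\<^sup>2"
        using L2_norm_add_power2[OF aL L2_01_scale[OF hL, of c]] in1 in2 by simp
      finally have "(cmod z)\<^sup>2 / (L2_norm h)\<^sup>2 \<le> (1/4)^n"
        using gd[of n] by linarith
      then have "(cmod z)\<^sup>2 \<le> (1/4)^n * (L2_norm h)\<^sup>2"
        using hp by (simp add: field_simps)
      also have "\<dots> = ((1/2)^n * L2_norm h)\<^sup>2"
        by (simp add: power2_eq_square mult_ac flip: power_mult_distrib)
      finally show ?thesis
        unfolding z_def using hp by (intro power2_le_imp_le[OF _ mult_nonneg_nonneg]) auto
    qed
    have "cmod (L2_inner (\<lambda>t. f t - p t) h) \<le> (1/2)^n * L2_norm h + L2_norm (\<lambda>t. p t - g n t) * L2_norm h" for n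
    proof -
      have "L2_inner (\<lambda>t. f t - p t) h = L2_inner (\<lambda>t. f t - g n t) h - L2_inner (\<lambda>t. p t - g n t) h"
        using f pL gL hL by (simp add: L2_inner_diff_left L2_01_diff)
      then have "cmod (L2_inner (\<lambda>t. f t - p t) h) \<le> cmod (L2_inner (\<lambda>t. f t - g n t) h) + cmod (L2_inner (\<lambda>t. p t - g n t) h)"
        by (simp add: norm_triangle_ineq4)
      with *[of n] L2_Cauchy_Schwarz[OF L2_01_diff[OF pL gL[of n]] hL] show ?thesis by linarith
    qed
    moreover have "(\<lambda>n. (1/2)^n * L2_norm h + L2_norm (\<lambda>t. p t - g n t) * L2_norm h) \<longlonglongrightarrow> 0 * L2_norm h + 0 * L2_norm h"
      by (intro tendsto_intros lim LIMSEQ_power_zero) simp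
    ultimately have "cmod (L2_inner (\<lambda>t. f t - p t) h) \<le> 0"
      by (intro LIMSEQ_le_const) auto
    then show ?thesis by simp
  qed
  ultimately show ?thesis by blast
qed

section \<open>A finite system of Cauchy type\<close>

text \<open>Both sides are polynomials of degree below \<open>N\<close> that agree at
  \<open>N\<close> distinct nodes. Divided by the nodal polynomial, this is a partial fraction
  decomposition.\<close>

lemma Lagrange_interpolation_poly:
  fixes y :: "nat \<Rightarrow> 'a::field"
  assumes inj: "inj_on y {..<N}" and deg: "degree p < N"
  shows "poly p s = (\<Sum>j<N. poly p (y j) * (\<Prod>i\<in>{..<N}-{j}. (s - y i) / (y j - y i)))"
proof -
  define L where "L j = (\<Prod>i\<in>{..<N}-{j}. smult (inverse (y j - y i)) [:- y i, 1:])" for j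
  define q where "q = (\<Sum>j<N. smult (poly p (y j)) (L j))"
  have poly_L: "poly (L j) s = (\<Prod>i\<in>{..<N}-{j}. (s - y i) / (y j - y i))" for j s
    unfolding L_def poly_prod by (intro prod.cong) (auto simp: divide_inverse algebra_simps)
  have "degree (L j) \<le> N - 1" if "j < N" for j
  proof -
    have "degree (L j) \<le> (\<Sum>i\<in>{..<N}-{j}. degree (smult (inverse (y j - y i)) [:- y i, 1:]))"
      unfolding L_def using degree_prod_sum_le[of "{..<N}-{j}" "\<lambda>i. smult (inverse (y j - y i)) [:- y i, 1:]"]
      by (simp only: o_def finite_Diff finite_lessThan)
    also have "\<dots> \<le> (\<Sum>i\<in>{..<N}-{j}. 1)"
      by (intro sum_mono) (auto intro: order_trans[OF degree_smult_le])
    also have "\<dots> = N - 1" using that by simp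
    finally show ?thesis .
  qed
  then have "degree q \<le> N - 1"
    unfolding q_def by (intro degree_sum_le) (auto intro: order_trans[OF degree_smult_le])
  moreover have "poly q (y k) = poly p (y k)" if k: "k < N" for k
  proof -
    have "poly (L j) (y k) = (if j = k then 1 else 0)" if j: "j < N" for j
    proof (cases "j = k")
      case True
      have "(y k - y i) / (y j - y i) = 1" if "i \<in> {..<N} - {j}" for i
        using that inj k j True by (auto dest: inj_onD)
      then show ?thesis using True by (simp add: poly_L)
    next
      case False
      then show ?thesis unfolding poly_L using k by (auto intro!: prod_zero)
    qed
    then have "poly q (y k) = (\<Sum>j<N. poly p (y j) * (if j = k then 1 else 0))"
      unfolding q_def poly_sum by (intro sum.cong) auto
    also have "\<dots> = poly p (y k)"
      using k by (simp add: if_distrib[of "times _"] sum.delta cong: if_cong)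
    finally show ?thesis .
  qed
  ultimately have "q = p"
    using deg inj
    by (intro poly_eqI_degree[of "y ` {..<N}"]) (auto simp: card_image)
  then have "poly p s = poly q s" by simp
  also have "\<dots> = (\<Sum>j<N. poly p (y j) * (\<Prod>i\<in>{..<N}-{j}. (s - y i) / (y j - y i)))"
    by (simp add: q_def poly_sum poly_L)
  finally show ?thesis .
qed

text \<open>
  The rational function \<open>\<Sum>j<N. a j / (s + x j + 1)\<close> must vanish at \<open>x k\<close> for \<open>k \<noteq> n\<close> and equal
  \<open>1\<close> at \<open>x n\<close>, so its numerator is \<open>C * (\<Prod>k\<noteq>n. s - x k)\<close>; the coefficients are the residues.
\<close>

lemma Cauchy_system_solution:
  fixes x :: "nat \<Rightarrow> real"
  assumes inj: "inj_on x {..<N}" and pos: "\<And>k. 0 < x k" and n: "n < N"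
  shows "\<exists>a. (\<forall>k<N. (\<Sum>j<N. a j / (x k + x j + 1)) = (if k = n then 1 else 0)) \<and>
    a n = (2 * x n + 1) * (\<Prod>k\<in>{..<N} - {n}. ((x n + x k + 1) / (x n - x k))\<^sup>2)"
proof -
  define I where "I = {..<N} - {n}"
  \<comment> \<open>The value \<open>1\<close> at \<open>x n\<close> forces this \<open>C\<close>:
    the denominator at \<open>x n\<close> divided by the product of the differences.\<close>
  define C where "C = (\<Prod>j<N. x n + x j + 1) / (\<Prod>k\<in>I. x n - x k)"
  define p where "p = smult C (\<Prod>k\<in>I. [:- x k, 1:])"
  \<comment> \<open>The \<open>y j\<close> are the poles, and \<open>a j\<close> is the residue at
    \<open>y j\<close> of \<open>p\<close> divided by the product of all
    \<open>s - y i\<close>.\<close>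
  define y where "y j = - x j - 1" for j
  define a where "a j = poly p (y j) / (\<Prod>i\<in>{..<N}-{j}. y j - y i)" for j
  have poly_p: "poly p s = C * (\<Prod>k\<in>I. s - x k)" for s
    by (simp add: p_def poly_prod)
  have finI: "finite I" "card I = N - 1" using n by (auto simp: I_def)
  have "degree (\<Prod>k\<in>I. [:- x k, 1:]) \<le> (\<Sum>k\<in>I. degree [:- x k, 1:])"
    using degree_prod_sum_le[OF finI(1), of "\<lambda>k. [:- x k, 1:]"] by (simp add: o_def)
  also have "\<dots> < N" using finI n by simp
  finally have deg: "degree p < N"
    unfolding p_def by (rule le_less_trans[OF degree_smult_le])
  have injy: "inj_on y {..<N}" using inj by (auto simp: inj_on_def y_def)
  have nz: "(\<Prod>k\<in>I. x n - x k) \<noteq> 0"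
    using inj n by (auto simp: I_def dest: inj_onD)
  have pos2: "0 < x i + x j + 1" for i j
    using pos[of i] pos[of j] by linarith
  show ?thesis
  proof (intro exI[of _ a] conjI allI impI)
    fix k assume k: "k < N"
    define D where "D = (\<Prod>i<N. x k + x i + 1)"
    have D: "D > 0" unfolding D_def using pos2 by (intro prod_pos) auto
    have "poly p (x k) = (\<Sum>j<N. poly p (y j) * (\<Prod>i\<in>{..<N}-{j}. (x k - y i) / (y j - y i)))"
      by (rule Lagrange_interpolation_poly[OF injy deg])
    \<comment> \<open>\<open>D\<close> is the common denominator at \<open>x k\<close>; taking it
      out turns the interpolation formula into partial fractions.\<close>
    also have "\<dots> = (\<Sum>j<N. D * (a j / (x k + x j + 1)))"
    proof (rule sum.cong)
      fix j assume "j \<in> {..<N}"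
      then have "D = (x k + x j + 1) * (\<Prod>i\<in>{..<N}-{j}. x k + x i + 1)"
        unfolding D_def by (subst prod.remove[of _ j]) auto
      moreover have "(\<Prod>i\<in>{..<N}-{j}. x k + x i + 1) = (\<Prod>i\<in>{..<N}-{j}. x k - y i)"
        by (intro prod.cong) (auto simp: y_def)
      ultimately show "poly p (y j) * (\<Prod>i\<in>{..<N}-{j}. (x k - y i) / (y j - y i)) = D * (a j / (x k + x j + 1))"
        using pos2[of k j] by (simp add: a_def prod_dividef)
    qed simp
    also have "\<dots> = D * (\<Sum>j<N. a j / (x k + x j + 1))"
      by (simp add: sum_distrib_left)
    finally have "(\<Sum>j<N. a j / (x k + x j + 1)) = poly p (x k) / D"
      using D by (simp add: field_simps)
    also have "\<dots> = (if k = n then 1 else 0)"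
    proof (cases "k = n")
      case True
      then have "C = D / (\<Prod>k\<in>I. x n - x k)" by (simp add: C_def D_def)
      then show ?thesis using True D nz by (simp add: poly_p)
    next
      case False
      then have "(\<Prod>i\<in>I. x k - x i) = 0"
        using k finI by (auto intro!: prod_zero simp: I_def)
      then show ?thesis using False by (simp add: poly_p)
    qed
    finally show "(\<Sum>j<N. a j / (x k + x j + 1)) = (if k = n then 1 else 0)" .
  next
    have C: "C = (2 * x n + 1) * (\<Prod>k\<in>I. (x n + x k + 1) / (x n - x k))"
      unfolding C_def I_def using n by (subst prod.remove[of _ n]) (auto simp: prod_dividef)
    have "a n = C * (\<Prod>k\<in>I. (y n - x k) / (y n - y k))"
      by (simp add: a_def poly_p prod_dividef flip: I_def)
    \<comment> \<open>Both differences change sign at the pole \<open>y n\<close>, so the product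
      contained in \<open>C\<close> appears a second time and yields the square.\<close>
    also have "(\<Prod>k\<in>I. (y n - x k) / (y n - y k)) = (\<Prod>k\<in>I. (x n + x k + 1) / (x n - x k))"
    proof (rule prod.cong)
      fix k assume "k \<in> I"
      then have "x n - x k \<noteq> 0" "x k - x n \<noteq> 0"
        using inj n by (auto simp: I_def dest: inj_onD)
      then show "(y n - x k) / (y n - y k) = (x n + x k + 1) / (x n - x k)"
        by (simp add: y_def field_simps)
    qed simp
    finally have "a n = (2 * x n + 1) * (\<Prod>k\<in>I. (x n + x k + 1) / (x n - x k))\<^sup>2"
      by (simp add: C power2_eq_square)
    then show "a n = (2 * x n + 1) * (\<Prod>k\<in>{..<N} - {n}. ((x n + x k + 1) / (x n - x k))\<^sup>2)"
      by (simp only: prod_power_distrib I_def)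
  qed
qed

section \<open>Products over the exponents\<close>

lemma prod_over_distance_below:
  fixes x :: real
  shows "(\<Prod>k<n. x / (real n - real k)) = x ^ n / fact n"
proof -
  have "(\<Prod>k<n. x / (real n - real k)) = (\<Prod>k<n. x / real (Suc (n - Suc k)))"
    by (intro prod.cong) (auto simp: of_nat_diff)
  also have "\<dots> = (\<Prod>k<n. x / real (Suc k))"
    by (rule prod.nat_diff_reindex[of "\<lambda>k. x / real (Suc k)"])
  also have "\<dots> = x ^ n / fact n"
    by (induction n) (auto simp: divide_simps)
  finally show ?thesis .
qed

lemma prod_over_distance_above:
  fixes x :: real
  shows "(\<Prod>k\<in>{Suc n..<Suc n + j}. x / (real k - real n)) = x ^ j / fact j"
  by (induction j) (auto simp: divide_simps)

text \<open>One term of the exponential series of \<open>\<eta> * x\<close> is at most the sum. A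
  small \<open>\<eta>\<close> gives a small exponential rate at the price of the factor
  \<open>(1 / \<eta>) ^ j\<close>.\<close>

lemma power_over_fact_le:
  fixes x \<eta> :: real
  assumes "0 \<le> x" "0 < \<eta>"
  shows "x ^ j / fact j \<le> (1 / \<eta>) ^ j * exp (\<eta> * x)"
proof -
  have "(\<eta> * x) ^ j / fact j \<le> exp (\<eta> * x)"
  proof -
    have "(\<Sum>i\<in>{j}. (\<eta> * x) ^ i /\<^sub>R fact i) \<le> (\<Sum>i. (\<eta> * x) ^ i /\<^sub>R fact i)"
      using assms by (intro sum_le_suminf summable_exp_generic) auto
    then show ?thesis by (simp add: exp_def field_simps)
  qed
  then have "(1 / \<eta>) ^ j * ((\<eta> * x) ^ j / fact j) \<le> (1 / \<eta>) ^ j * exp (\<eta> * x)"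
    using assms by (intro mult_left_mono) auto
  moreover have "(1 / \<eta>) ^ j * ((\<eta> * x) ^ j / fact j) = x ^ j / fact j"
    using assms by (simp add: power_mult_distrib power_divide)
  ultimately show ?thesis by simp
qed

text \<open>The indices below and above \<open>n\<close> contribute \<open>x ^ n / fact n\<close>
  and \<open>x ^ j / fact j\<close> with \<open>n + j = m - 1\<close>; each is estimated by
  \<open>power_over_fact_le\<close>.\<close>

lemma prod_over_distance_le:
  fixes x \<eta> :: real
  assumes x: "0 \<le> x" and \<eta>: "0 < \<eta>" and n: "n < m"
  shows "(\<Prod>k\<in>{..<m} - {n}. x / \<bar>real n - real k\<bar>) \<le> (1 / \<eta>) ^ (m - 1) * exp (2 * \<eta> * x)"
proof -
  obtain j where m: "m = Suc n + j"
    using n by (metis add_Suc less_imp_Suc_add add_Suc_shift)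
  have set: "{..<m} - {n} = {..<n} \<union> {Suc n..<Suc n + j}"
    using m by auto
  have "(\<Prod>k\<in>{..<m} - {n}. x / \<bar>real n - real k\<bar>) =
      (\<Prod>k<n. x / \<bar>real n - real k\<bar>) * (\<Prod>k\<in>{Suc n..<Suc n + j}. x / \<bar>real n - real k\<bar>)"
    unfolding set by (intro prod.union_disjoint) auto
  also have "(\<Prod>k<n. x / \<bar>real n - real k\<bar>) = x ^ n / fact n"
    unfolding prod_over_distance_below[symmetric] by (intro prod.cong) auto
  also have "(\<Prod>k\<in>{Suc n..<Suc n + j}. x / \<bar>real n - real k\<bar>) = x ^ j / fact j"
    unfolding prod_over_distance_above[of x n, symmetric] by (intro prod.cong) auto
  also have "x ^ n / fact n * (x ^ j / fact j) \<le>
      ((1 / \<eta>) ^ n * exp (\<eta> * x)) * ((1 / \<eta>) ^ j * exp (\<eta> * x))"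
    using x \<eta> by (intro mult_mono power_over_fact_le) auto
  also have "\<dots> = (1 / \<eta>) ^ (m - 1) * exp (2 * \<eta> * x)"
    using mult_exp_exp[of "\<eta> * x" "\<eta> * x"] by (simp add: m power_add mult_ac)
  finally show ?thesis .
qed

section \<open>Exponents with gaps and summable reciprocals\<close>

locale muntz_exponents =
  fixes \<Lambda> :: "nat \<Rightarrow> real" and \<delta> :: real
  assumes pos: "\<And>n. 0 < \<Lambda> n"
    and summable_inverse: "summable (\<lambda>n. 1 / \<Lambda> n)"
    and gap_pos: "0 < \<delta>"
    and gap: "\<And>n. \<delta> \<le> \<Lambda> (Suc n) - \<Lambda> n"
begin

lemma gap_add: "\<Lambda> n + \<delta> * real j \<le> \<Lambda> (n + j)"
proof (induction j)
  case (Suc j)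
  then show ?case using gap[of "n + j"] by (simp add: algebra_simps)
qed simp

lemma gap_le: "n \<le> k \<Longrightarrow> \<delta> * (real k - real n) \<le> \<Lambda> k - \<Lambda> n"
  using gap_add[of n "k - n"] by (simp add: of_nat_diff)

lemma strict: "n < k \<Longrightarrow> \<Lambda> n < \<Lambda> k"
  using gap_le[of n k] mult_pos_pos[OF gap_pos, of "real k - real n"] by simp

lemma mono: "n \<le> k \<Longrightarrow> \<Lambda> n \<le> \<Lambda> k"
  using strict[of n k] by (cases "n = k") auto

lemma inj: "inj \<Lambda>"
  by (metis injI less_irrefl linorder_neqE_nat strict)

lemma gap_abs: "\<delta> * \<bar>real n - real k\<bar> \<le> \<bar>\<Lambda> n - \<Lambda> k\<bar>"
  using gap_le[of n k] gap_le[of k n] mono[of n k] mono[of k n] by (cases "n \<le> k") auto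

text \<open>Smallness of the tail of a convergent series, for arbitrary finite sets, so that one
  \<open>K\<close> serves both to count the exponents near \<open>\<Lambda> n\<close> and to sum
  over the far ones.\<close>

lemma tail_le:
  assumes "0 < \<zeta>"
  obtains K where "\<And>A. finite A \<Longrightarrow> A \<subseteq> {K..} \<Longrightarrow> (\<Sum>k\<in>A. 1 / \<Lambda> k) \<le> \<zeta>"
proof -
  obtain K where K: "norm (\<Sum>k. 1 / \<Lambda> (k + K)) < \<zeta>"
    using suminf_exist_split[OF assms summable_inverse] by auto
  show thesis
  proof (rule that)
    fix A assume A: "finite A" "A \<subseteq> {K..}"
    have "(\<Sum>k\<in>A. 1 / \<Lambda> k) = (\<Sum>k\<in>(\<lambda>k. k - K) ` A. 1 / \<Lambda> (k + K))"
      using A by (subst sum.reindex) (auto simp: inj_on_def subset_iff eq_diff_iff intro!: sum.cong)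
    also have "\<dots> \<le> (\<Sum>k. 1 / \<Lambda> (k + K))"
      using A pos summable_inverse
      by (intro sum_le_suminf) (auto simp: less_imp_le summable_iff_shift[of "\<lambda>n. 1 / \<Lambda> n"])
    also have "\<dots> \<le> \<zeta>" using K by simp
    finally show "(\<Sum>k\<in>A. 1 / \<Lambda> k) \<le> \<zeta>" .
  qed
qed

text \<open>
  The factors with \<open>\<Lambda> k < 2 * \<Lambda> n\<close> are compared with factorials, using that there are only
  \<open>o(\<Lambda> n)\<close> of them; each remaining factor is at most \<open>exp ((4 * \<Lambda> n + 2) / \<Lambda> k)\<close>.
\<close>

lemma Blaschke_product_le:
  assumes \<epsilon>: "0 < \<epsilon>"
  obtains C where "0 < C"
    "\<And>n N. n < N \<Longrightarrow> (\<Prod>k\<in>{..<N} - {n}. (\<Lambda> n + \<Lambda> k + 1) / \<bar>\<Lambda> n - \<Lambda> k\<bar>) \<le> C * exp (\<epsilon> * \<Lambda> n)"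
proof -
  \<comment> \<open>The factorials will contribute the rate \<open>6 * \<eta> / \<delta>\<close>,
    which takes half of \<open>\<epsilon>\<close>. The bound \<open>1\<close> keeps \<open>l\<close>
    nonnegative.\<close>
  define \<eta> where "\<eta> = min 1 (\<epsilon> * \<delta> / 12)"
  define l where "l = ln (1 / \<eta>)"
  \<comment> \<open>The other half of \<open>\<epsilon>\<close> pays for
    \<open>2 * l * \<zeta>\<close>, from the powers of \<open>1 / \<eta>\<close>, and for
    \<open>4 * \<zeta>\<close>, from the far factors.\<close>
  define \<zeta> where "\<zeta> = \<epsilon> / (8 + 4 * l)"
  have \<eta>: "0 < \<eta>" "\<eta> \<le> 1" "6 * \<eta> / \<delta> \<le> \<epsilon> / 2"
    using \<epsilon> gap_pos by (auto simp: \<eta>_def field_simps min_def)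
  have l: "0 \<le> l" using \<eta> by (simp add: l_def)
  have \<zeta>: "0 < \<zeta>" "\<zeta> * (4 + 2 * l) = \<epsilon> / 2"
    using \<epsilon> l by (auto simp: \<zeta>_def divide_simps)
  obtain K where K: "\<And>A. finite A \<Longrightarrow> A \<subseteq> {K..} \<Longrightarrow> (\<Sum>k\<in>A. 1 / \<Lambda> k) \<le> \<zeta>"
    using tail_le[OF \<zeta>(1)] by metis
  \<comment> \<open>\<open>B\<close> collects the part of the final exponent that does not depend on
    \<open>n\<close>.\<close>
  define B where "B = l * real K + 2 * \<eta> / \<delta> + real K * (2 + 2 / \<Lambda> 0) + 2 * \<zeta>"
  show thesis
  proof (rule that)
    show "0 < exp B" by simp
    fix n N :: nat assume n: "n < N"
    \<comment> \<open>\<open>L\<close> is the first far index; \<open>m\<close> cuts it off at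
      \<open>N\<close>, where the product ends.\<close>
    define L where "L = (LEAST k. 2 * \<Lambda> n \<le> \<Lambda> k)"
    define m where "m = min N L"
    have "\<exists>k. 2 * \<Lambda> n \<le> \<Lambda> k"
    proof -
      obtain k where "2 * \<Lambda> n / \<delta> < real k" using reals_Archimedean2 by blast
      then have "2 * \<Lambda> n < \<delta> * real k" using gap_pos by (simp add: field_simps)
      also have "\<dots> \<le> \<Lambda> k" using gap_add[of 0 k] pos[of 0] by simp
      finally show ?thesis by (intro exI[of _ k]) simp
    qed
    then have L: "2 * \<Lambda> n \<le> \<Lambda> L" unfolding L_def by (rule LeastI_ex)
    have near: "\<Lambda> k < 2 * \<Lambda> n" if "k < m" for k
      using that not_less_Least[of k "\<lambda>k. 2 * \<Lambda> n \<le> \<Lambda> k"] by (auto simp: m_def L_def)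
    have far: "2 * \<Lambda> n \<le> \<Lambda> k" if "m \<le> k" "k < N" for k
      using that mono[of L k] L by (simp add: m_def min_def split: if_splits)
    have nm: "n < m" "m \<le> N"
      using n L pos[of n] mono[of L n] by (auto simp: m_def not_less[symmetric])
    \<comment> \<open>Every index in \<open>{K..<m}\<close> contributes at least
      \<open>1 / (2 * \<Lambda> n)\<close> to a sum bounded by \<open>\<zeta>\<close>.\<close>
    have count: "real m \<le> real K + 2 * \<zeta> * \<Lambda> n"
    proof (cases "K \<le> m")
      case True
      have "(\<Sum>k\<in>{K..<m}. 1 / (2 * \<Lambda> n)) \<le> (\<Sum>k\<in>{K..<m}. 1 / \<Lambda> k)"
        using near pos by (intro sum_mono divide_left_mono) (auto simp: less_imp_le)
      also have "\<dots> \<le> \<zeta>" by (rule K) auto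
      finally show ?thesis using True pos[of n] by (simp add: field_simps of_nat_diff)
    next
      case False
      then show ?thesis using \<zeta> pos[of n] by (simp add: add_increasing2)
    qed
    define g where "g k = (\<Lambda> n + \<Lambda> k + 1) / \<bar>\<Lambda> n - \<Lambda> k\<bar>" for k
    have g0: "0 \<le> g k" for k
      using pos[of n] pos[of k] by (simp add: g_def)
    have set: "{..<N} - {n} = ({..<m} - {n}) \<union> {m..<N}"
      using nm by auto
    have "(\<Prod>k\<in>{..<N} - {n}. g k) = (\<Prod>k\<in>{..<m} - {n}. g k) * (\<Prod>k\<in>{m..<N}. g k)"
      unfolding set by (intro prod.union_disjoint) auto
    also have "\<dots> \<le> exp (l * (real K + 2 * \<zeta> * \<Lambda> n) + 2 * \<eta> * ((3 * \<Lambda> n + 1) / \<delta>)) *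
        exp (real K * (2 + 2 / \<Lambda> 0) + (4 * \<Lambda> n + 2) * \<zeta>)"
    proof (rule mult_mono)
      define x where "x = (3 * \<Lambda> n + 1) / \<delta>"
      have x: "0 \<le> x" using pos[of n] gap_pos by (simp add: x_def)
      have "(\<Prod>k\<in>{..<m} - {n}. g k) \<le> (\<Prod>k\<in>{..<m} - {n}. x / \<bar>real n - real k\<bar>)"
      proof (rule prod_mono, safe)
        fix k assume k: "k < m" "k \<noteq> n"
        have d: "0 < \<delta> * \<bar>real n - real k\<bar>" using k gap_pos by simp
        \<comment> \<open>Nearness bounds the numerator, and the gap condition bounds the
          denominator from below.\<close>
        have "g k \<le> (3 * \<Lambda> n + 1) / (\<delta> * \<bar>real n - real k\<bar>)"
          unfolding g_def using near[OF k(1)] gap_abs[of n k] d pos[of n]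
          by (intro frac_le) auto
        then show "g k \<le> x / \<bar>real n - real k\<bar>" by (simp add: x_def)
      qed (rule g0)
      also have "\<dots> \<le> (1 / \<eta>) ^ (m - 1) * exp (2 * \<eta> * x)"
        using prod_over_distance_le[OF x \<eta>(1) nm(1)] .
      also have "(1 / \<eta>) ^ (m - 1) = exp (l * real (m - 1))"
        using \<eta> by (simp add: l_def exp_of_nat2_mult)
      also have "\<dots> * exp (2 * \<eta> * x) = exp (l * real (m - 1) + 2 * \<eta> * x)"
        by (simp add: exp_add)
      also have "\<dots> \<le> exp (l * (real K + 2 * \<zeta> * \<Lambda> n) + 2 * \<eta> * x)"
        using count l by (simp add: mult_left_mono)
      finally show "(\<Prod>k\<in>{..<m} - {n}. g k) \<le> exp (l * (real K + 2 * \<zeta> * \<Lambda> n) + 2 * \<eta> * ((3 * \<Lambda> n + 1) / \<delta>))"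
        by (simp add: x_def)
      have "(\<Prod>k\<in>{m..<N}. g k) \<le> (\<Prod>k\<in>{m..<N}. exp ((4 * \<Lambda> n + 2) / \<Lambda> k))"
      proof (rule prod_mono, safe)
        fix k assume "k \<in> {m..<N}"
        then have k: "2 * \<Lambda> n \<le> \<Lambda> k" using far by auto
        have "g k = 1 + (2 * \<Lambda> n + 1) / (\<Lambda> k - \<Lambda> n)"
          using k pos[of n] by (simp add: g_def field_simps)
        \<comment> \<open>For a far index \<open>\<Lambda> n\<close> is at most half of
          \<open>\<Lambda> k\<close>.\<close>
        also have "\<dots> \<le> 1 + (2 * \<Lambda> n + 1) / (\<Lambda> k / 2)"
          using k pos[of n] pos[of k] by (intro add_left_mono divide_left_mono) auto
        also have "\<dots> = 1 + (4 * \<Lambda> n + 2) / \<Lambda> k"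
          by (simp add: field_simps)
        also have "\<dots> \<le> exp ((4 * \<Lambda> n + 2) / \<Lambda> k)"
          by (rule exp_ge_add_one_self)
        finally show "g k \<le> exp ((4 * \<Lambda> n + 2) / \<Lambda> k)" .
      qed (rule g0)
      also have "\<dots> = exp (\<Sum>k\<in>{m..<N}. (4 * \<Lambda> n + 2) / \<Lambda> k)"
        by (simp add: exp_sum)
      also have "\<dots> \<le> exp (real K * (2 + 2 / \<Lambda> 0) + (4 * \<Lambda> n + 2) * \<zeta>)"
      proof -
        \<comment> \<open>The tail bound starts at \<open>K\<close>. At most \<open>K\<close> terms
          precede it, each bounded by a constant because the indices are far.\<close>
        have "(\<Sum>k\<in>{m..<N}. (4 * \<Lambda> n + 2) / \<Lambda> k) =
            (\<Sum>k\<in>{m..<N} \<inter> {..<K}. (4 * \<Lambda> n + 2) / \<Lambda> k) + (\<Sum>k\<in>{m..<N} \<inter> {K..}. (4 * \<Lambda> n + 2) / \<Lambda> k)"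
          by (subst sum.union_disjoint[symmetric]) (auto intro!: sum.cong)
        also have "(\<Sum>k\<in>{m..<N} \<inter> {..<K}. (4 * \<Lambda> n + 2) / \<Lambda> k) \<le> (\<Sum>k\<in>{m..<N} \<inter> {..<K}. 2 + 2 / \<Lambda> 0)"
        proof (rule sum_mono)
          fix k assume "k \<in> {m..<N} \<inter> {..<K}"
          then have "2 * \<Lambda> n \<le> \<Lambda> k" using far by auto
          then have "4 * \<Lambda> n / \<Lambda> k \<le> 2" using pos[of k] by (simp add: field_simps)
          moreover have "2 / \<Lambda> k \<le> 2 / \<Lambda> 0"
            using pos mono[of 0 k] by (intro divide_left_mono) auto
          ultimately show "(4 * \<Lambda> n + 2) / \<Lambda> k \<le> 2 + 2 / \<Lambda> 0"
            by (simp add: add_divide_distrib)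
        qed
        also have "\<dots> \<le> real K * (2 + 2 / \<Lambda> 0)"
        proof -
          have "card ({m..<N} \<inter> {..<K}) \<le> card {..<K}" by (intro card_mono) auto
          then show ?thesis using pos[of 0] by (simp add: mult_right_mono)
        qed
        also have "(\<Sum>k\<in>{m..<N} \<inter> {K..}. (4 * \<Lambda> n + 2) / \<Lambda> k) = (4 * \<Lambda> n + 2) * (\<Sum>k\<in>{m..<N} \<inter> {K..}. 1 / \<Lambda> k)"
          by (simp add: sum_distrib_left)
        also have "\<dots> \<le> (4 * \<Lambda> n + 2) * \<zeta>"
          using pos[of n] by (intro mult_left_mono K) auto
        finally show ?thesis by simp
      qed
      finally show "(\<Prod>k\<in>{m..<N}. g k) \<le> exp (real K * (2 + 2 / \<Lambda> 0) + (4 * \<Lambda> n + 2) * \<zeta>)" .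
    qed (auto intro: prod_nonneg g0)
    also have "\<dots> = exp (B + (\<zeta> * (4 + 2 * l) + 6 * \<eta> / \<delta>) * \<Lambda> n)"
      unfolding exp_add[symmetric] B_def by (rule arg_cong[where f = exp]) (simp add: algebra_simps add_divide_distrib)
    also have "\<dots> \<le> exp (B + \<epsilon> * \<Lambda> n)"
      using \<eta>(3) \<zeta>(2) pos[of n] by (simp add: mult_right_mono)
    also have "\<dots> = exp B * exp (\<epsilon> * \<Lambda> n)" by (rule exp_add)
    finally show "(\<Prod>k\<in>{..<N} - {n}. (\<Lambda> n + \<Lambda> k + 1) / \<bar>\<Lambda> n - \<Lambda> k\<bar>) \<le> exp B * exp (\<epsilon> * \<Lambda> n)"
      by (simp add: g_def)
  qed
qed

end

section \<open>Biorthogonal families and Muntz systems\<close>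

text \<open>The vector for index \<open>n\<close> is the rescaled component of \<open>x n\<close>
  orthogonal to the other members; minimality makes this component nonzero.\<close>

lemma biorthogonal_family_exists:
  assumes S: "range x \<subseteq> L2_01" and min: "minimal_system x"
  shows "\<exists>r. biorthogonal_family (closed_span (range x)) x r"
proof -
  have "\<exists>w\<in>closed_span (range x). L2_inner (x n) w = 1 \<and> (\<forall>m. m \<noteq> n \<longrightarrow> L2_inner (x m) w = 0)" for n
  proof -
    let ?T = "x ` (UNIV - {n})"
    have T: "?T \<subseteq> L2_01" and xn: "x n \<in> L2_01" using S by auto
    obtain p where p: "p \<in> closed_span ?T" and orth: "\<And>h. h \<in> ?T \<Longrightarrow> L2_inner (\<lambda>t. x n t - p t) h = 0"
      using L2_projection[OF T xn] by blast
    define w where "w t = x n t - p t" for t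
    have pL: "p \<in> L2_01" using closed_span_L2[OF p] .
    have wL: "w \<in> L2_01" unfolding w_def by (intro L2_01_diff xn pL)
    have orth': "L2_inner h w = 0" if "h \<in> ?T" for h
      using orth[OF that] L2_inner_commute[of h w] by (simp add: w_def[abs_def])
    have "L2_norm w \<noteq> 0"
    proof
      assume "L2_norm w = 0"
      then have "AE t in unit_lebesgue. p t = x n t"
        using L2_norm_zero_iff_AE[OF wL] by (auto simp: w_def elim: eventually_mono)
      then have "x n \<in> closed_span ?T"
        by (rule closed_span_cong_AE[OF T p])
      then show False using min by (simp add: minimal_system_def)
    qed
    \<comment> \<open>\<open>p\<close> lies in the closed span of the other members and is thus
      orthogonal to \<open>w\<close>, so pairing \<open>x n\<close> with \<open>w\<close> gives the
      squared norm of \<open>w\<close>.\<close>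
    have "L2_inner w w = L2_inner (x n) w - L2_inner p w"
      using L2_inner_diff_left[OF xn pL wL] by (simp add: w_def[abs_def])
    then have xw: "L2_inner (x n) w = complex_of_real ((L2_norm w)\<^sup>2)"
      using closed_span_orthogonal[OF T p wL orth'] by (simp add: L2_inner_self)
    define c where "c = complex_of_real (1 / (L2_norm w)\<^sup>2)"
    have inner: "L2_inner h (\<lambda>t. c * w t) = c * L2_inner h w" for h
      by (subst L2_inner_commute, subst L2_inner_scale_left, subst L2_inner_commute) (simp add: c_def)
    have "closed_span ?T \<subseteq> closed_span (range x)"
      using closed_span_superset[OF S] S by (intro closed_span_minimal) auto
    then have "w \<in> closed_span (range x)"
      unfolding w_def using closed_span_superset[OF S] p by (intro closed_span_diff S) auto
    then have "(\<lambda>t. c * w t) \<in> closed_span (range x)"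
      by (rule closed_span_scale[OF S])
    moreover have "L2_inner (x n) (\<lambda>t. c * w t) = 1"
      unfolding inner xw using \<open>L2_norm w \<noteq> 0\<close> by (simp add: c_def)
    moreover have "L2_inner (x m) (\<lambda>t. c * w t) = 0" if "m \<noteq> n" for m
      unfolding inner using that by (simp add: orth')
    ultimately show ?thesis by blast
  qed
  then obtain r where "\<And>n. r n \<in> closed_span (range x)" "\<And>n. L2_inner (x n) (r n) = 1"
    "\<And>n m. m \<noteq> n \<Longrightarrow> L2_inner (x m) (r n) = 0"
    by metis
  then show ?thesis
    unfolding biorthogonal_family_def by (intro exI[of _ r]) auto
qed

text \<open>The difference of two candidates lies in the closed span and is orthogonal to its
  generators, hence to itself.\<close>

lemma biorthogonal_family_unique:
  assumes S: "range x \<subseteq> L2_01"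
    and r: "biorthogonal_family (closed_span (range x)) x r"
    and r': "biorthogonal_family (closed_span (range x)) x r'"
  shows "AE t in unit_lebesgue. r n t = r' n t"
proof -
  let ?d = "\<lambda>t. r n t - r' n t"
  have rH: "r n \<in> closed_span (range x)" "r' n \<in> closed_span (range x)"
    using r r' by (auto simp: biorthogonal_family_def)
  have d: "?d \<in> closed_span (range x)" by (rule closed_span_diff[OF S rH])
  have rx: "L2_inner (r n) (x m) = L2_inner (r' n) (x m)" for m
    unfolding L2_inner_commute[of _ "x m"] using r r' by (simp add: biorthogonal_family_def)
  have "L2_inner (x m) ?d = 0" for m
  proof -
    have "x m \<in> L2_01" using S by auto
    then have "L2_inner ?d (x m) = 0"
      by (simp only: L2_inner_diff_left[OF rH[THEN closed_span_L2]] rx diff_self)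
    then show ?thesis by (subst L2_inner_commute) simp
  qed
  then have "\<And>s. s \<in> range x \<Longrightarrow> L2_inner s ?d = 0" by blast
  then have "L2_inner ?d ?d = 0"
    by (rule closed_span_orthogonal[OF S d closed_span_L2[OF d]])
  then have "L2_norm ?d = 0" by (simp add: L2_inner_self)
  then show ?thesis
    using L2_norm_zero_iff_AE[OF closed_span_L2[OF d]] by simp
qed

section \<open>The powers as vectors, and the slit disk\<close>

lemma muntz_system_L2:
  assumes "0 < \<Lambda> n"
  shows "muntz_system \<Lambda> n \<in> L2_01"
proof (rule L2_norm_bound(1)[of _ 1])
  show "muntz_system \<Lambda> n \<in> borel_measurable unit_lebesgue"
    unfolding muntz_system_def[abs_def] by (intro borel_measurable_unit_lebesgue) measurable
  show "cmod (muntz_system \<Lambda> n t) \<le> 1" if "t \<in> {0<..<1}" for t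
    using that assms by (simp add: muntz_system_def powr_le1)
qed simp

text \<open>The Gram matrix is a Cauchy matrix, which brings \<open>Cauchy_system_solution\<close>
  into play.\<close>

lemma muntz_system_inner:
  assumes "0 < \<Lambda> m" "0 < \<Lambda> n"
  shows "L2_inner (muntz_system \<Lambda> m) (muntz_system \<Lambda> n) = complex_of_real (1 / (\<Lambda> m + \<Lambda> n + 1))"
proof -
  let ?a = "\<Lambda> m + \<Lambda> n"
  have eq: "muntz_system \<Lambda> m t * cnj (muntz_system \<Lambda> n t) = complex_of_real (t powr ?a)" for t
    by (simp add: muntz_system_def powr_add)
  have "complex_integrable unit_lebesgue (\<lambda>t. complex_of_real (t powr ?a))"
    using L2_inner_integrable[OF muntz_system_L2[of \<Lambda> m] muntz_system_L2[of \<Lambda> n]] assms by (simp add: eq)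
  then have "integrable unit_lebesgue (\<lambda>t. t powr ?a)"
    using complex_of_real_integrable_eq by blast
  then have "(LINT t|unit_lebesgue. t powr ?a) = integral {0<..<1} (\<lambda>t. t powr ?a)"
    by (rule lebesgue_integral_eq_integral) simp
  also have "\<dots> = integral {0..1} (\<lambda>t. t powr ?a)"
    by (simp add: integral_open_interval_real)
  also have "\<dots> = 1 / (?a + 1)"
    using has_integral_powr_from_0[of ?a 1] assms by (simp add: integral_unique)
  finally show ?thesis
    unfolding L2_inner_def eq by simp
qed

text \<open>The modulus attains its maximum on a compact set. This reduces uniform convergence on
  compact sets to closed disks.\<close>

lemma compact_subset_cball:
  assumes "compact K" "K \<subseteq> ball 0 (1::real)"
  obtains \<rho> where "\<rho> < 1" "K \<subseteq> cball (0::complex) \<rho>"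
proof (cases "K = {}")
  case True
  then show thesis using that[of 0] by simp
next
  case False
  obtain x where "x \<in> K" "\<forall>y\<in>K. cmod y \<le> cmod x"
    using continuous_attains_sup[OF assms(1) False, of cmod] by (auto intro: continuous_intros)
  moreover have "cmod x < 1" using \<open>x \<in> K\<close> assms(2) by auto
  moreover have "K \<subseteq> cball 0 (cmod x)" using \<open>\<forall>y\<in>K. cmod y \<le> cmod x\<close> by auto
  ultimately show thesis using that by blast
qed

text \<open>Inside the unit disk the slit is the branch cut of the logarithm, so openness of the
  slit disk and holomorphy of the powers can be read off.\<close>

lemma slit_disk_eq: "slit_disk = ball 0 1 - \<real>\<^sub>\<le>\<^sub>0"
proof -
  have "z \<in> ball 0 1 \<Longrightarrow> z \<in> complex_of_real ` {-1<..0} \<longleftrightarrow> z \<in> \<real>\<^sub>\<le>\<^sub>0" for z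
    by (auto simp: nonpos_Reals_def)
  then show ?thesis by (auto simp: slit_disk_def)
qed

section \<open>Coefficient bounds and minimality\<close>

context muntz_exponents
begin

lemma range_L2: "range (muntz_system \<Lambda>) \<subseteq> L2_01"
  using muntz_system_L2 pos by blast

text \<open>The coefficient is the inner product with the explicit dual vector \<open>q\<close>,
  whose norm the product estimate controls. \<open>C\<close> does not depend on \<open>J\<close>,
  \<open>c\<close> or \<open>n\<close>, so the bound survives passage to the closure.\<close>

lemma muntz_coefficient_le:
  assumes \<epsilon>: "0 < \<epsilon>"
  obtains C where "0 < C"
    "\<And>J c n. finite J \<Longrightarrow> n \<in> J \<Longrightarrow>
      cmod (c n) \<le> C * exp (\<epsilon> * \<Lambda> n) * L2_norm (\<lambda>t. \<Sum>k\<in>J. c k * muntz_system \<Lambda> k t)"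
proof -
  obtain B where B: "0 < B"
    "\<And>n N. n < N \<Longrightarrow> (\<Prod>k\<in>{..<N} - {n}. (\<Lambda> n + \<Lambda> k + 1) / \<bar>\<Lambda> n - \<Lambda> k\<bar>) \<le> B * exp (\<epsilon> / 2 * \<Lambda> n)"
    using Blaschke_product_le[of "\<epsilon> / 2"] \<epsilon> by auto
  \<comment> \<open>\<open>M\<close> absorbs the polynomial factor \<open>1 + \<Lambda> n\<close>
    into a second \<open>exp (\<epsilon> / 2 * \<Lambda> n)\<close>.\<close>
  define M where "M = max 1 (2 / \<epsilon>)"
  have M: "0 < M" "1 \<le> M" "1 \<le> M * (\<epsilon> / 2)"
    using \<epsilon> by (auto simp: M_def max_def field_simps)
  have M_le: "1 + \<Lambda> n \<le> M * exp (\<epsilon> / 2 * \<Lambda> n)" for n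
  proof -
    have "1 + 1 * \<Lambda> n \<le> M + (M * (\<epsilon> / 2)) * \<Lambda> n"
      using M pos[of n] by (intro add_mono mult_right_mono) auto
    also have "\<dots> = M * (1 + \<epsilon> / 2 * \<Lambda> n)" by (simp add: algebra_simps)
    also have "\<dots> \<le> M * exp (\<epsilon> / 2 * \<Lambda> n)"
      using M by (intro mult_left_mono exp_ge_add_one_self) auto
    finally show ?thesis by simp
  qed
  show thesis
  proof (rule that[of "M * B"])
    show "0 < M * B" using M B by simp
    fix J :: "nat set" and n and c :: "nat \<Rightarrow> complex" assume J: "finite J" "n \<in> J"
    let ?f = "\<lambda>t. \<Sum>k\<in>J. c k * muntz_system \<Lambda> k t"
    \<comment> \<open>The Cauchy system is solved for initial segments, so \<open>J\<close> is
      embedded into one.\<close>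
    define N where "N = Suc (Max J)"
    have JN: "J \<subseteq> {..<N}" using J by (auto simp: N_def less_Suc_eq_le)
    then have n: "n < N" using J by auto
    have injN: "inj_on \<Lambda> {..<N}" using inj by (rule inj_on_subset) simp
    obtain a where a: "\<forall>k<N. (\<Sum>j<N. a j / (\<Lambda> k + \<Lambda> j + 1)) = (if k = n then 1 else 0)"
      and an: "a n = (2 * \<Lambda> n + 1) * (\<Prod>k\<in>{..<N} - {n}. ((\<Lambda> n + \<Lambda> k + 1) / (\<Lambda> n - \<Lambda> k))\<^sup>2)"
      using Cauchy_system_solution[OF injN pos n] by blast
    define q where "q t = (\<Sum>j<N. complex_of_real (a j) * muntz_system \<Lambda> j t)" for t
    have eL: "muntz_system \<Lambda> k \<in> L2_01" for k using range_L2 by auto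
    have qL: "q \<in> L2_01" unfolding q_def by (intro L2_01_sum L2_01_scale eL)
    have qe: "L2_inner q (muntz_system \<Lambda> k) = (if k = n then 1 else 0)" if "k < N" for k
    proof -
      have "L2_inner q (muntz_system \<Lambda> k) = (\<Sum>j<N. complex_of_real (a j) * complex_of_real (1 / (\<Lambda> j + \<Lambda> k + 1)))"
        unfolding q_def using pos eL by (subst L2_inner_sum_left) (auto simp: muntz_system_inner)
      also have "\<dots> = complex_of_real (\<Sum>j<N. a j / (\<Lambda> k + \<Lambda> j + 1))"
        by (simp add: add.commute)
      finally show ?thesis using a that by simp
    qed
    have eq: "L2_inner (muntz_system \<Lambda> k) q = (if k = n then 1 else 0)" if "k < N" for k
      using qe[OF that] by (subst L2_inner_commute) auto
    \<comment> \<open>By duality, pairing \<open>q\<close> with its own expansion leaves only the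
      coefficient \<open>a n\<close>.\<close>
    have "L2_inner q q = (\<Sum>j<N. complex_of_real (a j) * L2_inner (muntz_system \<Lambda> j) q)"
      by (subst (1) q_def[abs_def]) (use eL qL in \<open>auto intro: L2_inner_sum_left\<close>)
    also have "\<dots> = (\<Sum>j<N. if j = n then complex_of_real (a j) else 0)"
      by (intro sum.cong) (auto simp: eq)
    also have "\<dots> = complex_of_real (a n)" using n by (simp add: sum.delta)
    finally have "complex_of_real ((L2_norm q)\<^sup>2) = complex_of_real (a n)"
      by (simp only: L2_inner_self)
    then have qq: "(L2_norm q)\<^sup>2 = a n" by (simp only: of_real_eq_iff)
    define P where "P = (\<Prod>k\<in>{..<N} - {n}. (\<Lambda> n + \<Lambda> k + 1) / \<bar>\<Lambda> n - \<Lambda> k\<bar>)"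
    have P: "0 \<le> P" "P \<le> B * exp (\<epsilon> / 2 * \<Lambda> n)"
      unfolding P_def using B(2)[OF n] pos by (auto intro!: prod_nonneg add_nonneg_nonneg simp: less_imp_le)
    have "a n = (2 * \<Lambda> n + 1) * P\<^sup>2"
      unfolding an P_def prod_power_distrib by (simp add: power_divide)
    \<comment> \<open>Replacing \<open>2 * \<Lambda> n + 1\<close> by a square allows the root to be
      taken.\<close>
    also have "\<dots> \<le> (1 + \<Lambda> n)\<^sup>2 * P\<^sup>2"
      by (intro mult_right_mono) (auto simp: power2_eq_square algebra_simps)
    also have "\<dots> = ((1 + \<Lambda> n) * P)\<^sup>2"
      by (simp add: power_mult_distrib)
    finally have "(L2_norm q)\<^sup>2 \<le> ((1 + \<Lambda> n) * P)\<^sup>2" using qq by simp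
    moreover have "0 \<le> (1 + \<Lambda> n) * P"
      using pos[of n] P(1) by simp
    ultimately have "L2_norm q \<le> (1 + \<Lambda> n) * P"
      by (rule power2_le_imp_le)
    also have "\<dots> \<le> (M * exp (\<epsilon> / 2 * \<Lambda> n)) * (B * exp (\<epsilon> / 2 * \<Lambda> n))"
      using P M_le[of n] M by (intro mult_mono) simp_all
    also have "\<dots> = M * B * exp (\<epsilon> * \<Lambda> n)"
      using exp_add[of "\<epsilon> / 2 * \<Lambda> n" "\<epsilon> / 2 * \<Lambda> n"] by (simp add: mult_ac)
    finally have q_le: "L2_norm q \<le> M * B * exp (\<epsilon> * \<Lambda> n)" .
    have "L2_inner ?f q = (\<Sum>k\<in>J. c k * L2_inner (muntz_system \<Lambda> k) q)"
      using eL qL by (intro L2_inner_sum_left)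
    also have "\<dots> = (\<Sum>k\<in>J. if k = n then c k else 0)"
      using JN by (intro sum.cong) (auto simp: eq subset_iff)
    also have "\<dots> = c n" using J by (simp add: sum.delta)
    finally have "cmod (c n) \<le> L2_norm ?f * L2_norm q"
      using L2_Cauchy_Schwarz[of ?f q] qL eL by (simp add: L2_01_sum L2_01_scale)
    also have "\<dots> \<le> L2_norm ?f * (M * B * exp (\<epsilon> * \<Lambda> n))"
      by (rule mult_left_mono[OF q_le L2_norm_nonneg])
    finally show "cmod (c n) \<le> M * B * exp (\<epsilon> * \<Lambda> n) * L2_norm ?f"
      by (simp add: mult.commute)
  qed
qed

text \<open>In the difference of the power with index \<open>n\<close> and a combination of the
  others, the coefficient at \<open>n\<close> is \<open>1\<close>, so the coefficient bound keeps
  its norm away from zero.\<close>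

lemma muntz_system_minimal: "minimal_system (muntz_system \<Lambda>)"
  unfolding minimal_system_def
proof (intro allI notI)
  let ?e = "muntz_system \<Lambda>"
  fix n assume n: "?e n \<in> closed_span (?e ` (UNIV - {n}))"
  obtain C where C: "0 < C" "\<And>J c n. finite J \<Longrightarrow> n \<in> J \<Longrightarrow>
      cmod (c n) \<le> C * exp (1 * \<Lambda> n) * L2_norm (\<lambda>t. \<Sum>k\<in>J. c k * ?e k t)"
    using muntz_coefficient_le[OF zero_less_one] by blast
  define D where "D = C * exp (1 * \<Lambda> n)"
  have D: "0 < D" using C by (simp add: D_def)
  then have "0 < 1 / D" by simp
  then obtain g where g: "g \<in> complex_span (?e ` (UNIV - {n}))" "L2_norm (\<lambda>t. ?e n t - g t) < 1 / D"
    by (rule closed_span_approx[OF n])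
  then obtain J c where J: "finite J" "J \<subseteq> UNIV - {n}" "g = (\<lambda>t. \<Sum>k\<in>J. c k * ?e k t)"
    using complex_span_image_obtains[OF g(1)] by blast
  let ?c = "\<lambda>k. if k = n then 1 else - c k"
  have "(\<Sum>k\<in>insert n J. ?c k * ?e k t) = ?e n t - g t" for t
  proof -
    have "(\<Sum>k\<in>J. ?c k * ?e k t) = (\<Sum>k\<in>J. - (c k * ?e k t))"
      using J(2) by (intro sum.cong) auto
    moreover have "n \<notin> J" using J(2) by auto
    ultimately show ?thesis using J(1) by (simp add: J(3) sum_negf)
  qed
  then have "1 \<le> D * L2_norm (\<lambda>t. ?e n t - g t)"
    using C(2)[of "insert n J" n ?c] J(1) by (simp add: D_def)
  with g(2) D show False by (simp add: field_simps)
qed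

section \<open>Series with subexponential coefficients\<close>

text \<open>For powers with exponents \<open>\<Lambda> n\<close> this is the analogue of a radius of
  convergence of at least one.\<close>

definition subexponential :: "(nat \<Rightarrow> complex) \<Rightarrow> bool" where
  "subexponential a \<longleftrightarrow> (\<forall>\<epsilon>>0. \<exists>C. \<forall>n. cmod (a n) \<le> C * exp (\<epsilon> * \<Lambda> n))"

text \<open>With \<open>\<epsilon>\<close> half of \<open>- ln \<rho>\<close> the terms are
  \<open>exp (- (\<epsilon> * \<Lambda> n))\<close>, which is dominated by
  \<open>1 / (\<epsilon> * \<Lambda> n)\<close>.\<close>

lemma summable_exp_powr:
  assumes \<rho>: "0 < \<rho>" "\<rho> < 1"
  obtains \<epsilon> where "0 < \<epsilon>" "summable (\<lambda>n. exp (\<epsilon> * \<Lambda> n) * \<rho> powr \<Lambda> n)"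
proof -
  define \<epsilon> where "\<epsilon> = - ln \<rho> / 2"
  have \<epsilon>: "0 < \<epsilon>" using \<rho> by (simp add: \<epsilon>_def)
  have "summable (\<lambda>n. exp (\<epsilon> * \<Lambda> n) * \<rho> powr \<Lambda> n)"
  proof (rule summable_comparison_test')
    show "summable (\<lambda>n. 1 / \<epsilon> * (1 / \<Lambda> n))"
      by (intro summable_mult summable_inverse)
    fix n
    have p: "0 < \<epsilon> * \<Lambda> n" using \<epsilon> pos[of n] by simp
    have "\<rho> powr \<Lambda> n = exp (- (2 * \<epsilon>) * \<Lambda> n)"
      using \<rho> by (simp add: powr_def \<epsilon>_def mult.commute)
    then have "exp (\<epsilon> * \<Lambda> n) * \<rho> powr \<Lambda> n = exp (- (\<epsilon> * \<Lambda> n))"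
      by (simp flip: exp_add)
    also have "\<dots> = 1 / exp (\<epsilon> * \<Lambda> n)" by (simp add: exp_minus field_simps)
    also have "\<dots> \<le> 1 / (\<epsilon> * \<Lambda> n)"
      using p exp_ge_add_one_self[of "\<epsilon> * \<Lambda> n"] by (intro divide_left_mono mult_pos_pos[OF exp_gt_zero p]) linarith+
    finally show "norm (exp (\<epsilon> * \<Lambda> n) * \<rho> powr \<Lambda> n) \<le> 1 / \<epsilon> * (1 / \<Lambda> n)"
      by simp
  qed
  with \<epsilon> show thesis by (rule that)
qed

lemma subexponential_summable:
  assumes a: "subexponential a" and \<rho>: "0 \<le> \<rho>" "\<rho> < 1"
  shows "summable (\<lambda>n. cmod (a n) * \<rho> powr \<Lambda> n)"
proof (cases "\<rho> = 0")
  case False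
  then have "0 < \<rho>" using \<rho> by simp
  obtain \<epsilon> where \<epsilon>: "0 < \<epsilon>" "summable (\<lambda>n. exp (\<epsilon> * \<Lambda> n) * \<rho> powr \<Lambda> n)"
    using summable_exp_powr[OF \<open>0 < \<rho>\<close> \<rho>(2)] .
  obtain C where C: "\<And>n. cmod (a n) \<le> C * exp (\<epsilon> * \<Lambda> n)"
    using a \<epsilon>(1) by (auto simp: subexponential_def)
  show ?thesis
  proof (rule summable_comparison_test')
    show "summable (\<lambda>n. C * (exp (\<epsilon> * \<Lambda> n) * \<rho> powr \<Lambda> n))"
      by (intro summable_mult \<epsilon>(2))
    show "norm (cmod (a n) * \<rho> powr \<Lambda> n) \<le> C * (exp (\<epsilon> * \<Lambda> n) * \<rho> powr \<Lambda> n)" for n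
      using mult_right_mono[OF C[of n], of "\<rho> powr \<Lambda> n"] by (simp add: mult_ac)
  qed
qed simp

definition muntz_series :: "(nat \<Rightarrow> complex) \<Rightarrow> complex \<Rightarrow> complex" where
  "muntz_series a z = (\<Sum>n. a n * z powr complex_of_real (\<Lambda> n))"

text \<open>For a real exponent the modulus of the power depends only on the modulus of
  \<open>z\<close>, so the estimates hold on full disks, across the slit.\<close>

lemma norm_muntz_term_le:
  assumes "cmod z \<le> \<rho>"
  shows "cmod (a n * z powr complex_of_real (\<Lambda> n)) \<le> cmod (a n) * \<rho> powr \<Lambda> n"
  using assms pos[of n] by (auto simp: norm_mult norm_powr_real_powr' intro!: mult_left_mono powr_mono2)

lemma muntz_series_sums:
  assumes a: "subexponential a" and z: "cmod z < 1"
  shows "(\<lambda>n. a n * z powr complex_of_real (\<Lambda> n)) sums muntz_series a z"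
  unfolding muntz_series_def
  by (rule summable_sums[OF summable_comparison_test'[OF subexponential_summable[OF a _ z]]])
     (auto intro: norm_muntz_term_le)

lemma muntz_series_uniform_limit:
  assumes a: "subexponential a" and \<rho>: "\<rho> < 1"
  shows "uniform_limit (cball 0 \<rho>) (\<lambda>N z. \<Sum>n<N. a n * z powr complex_of_real (\<Lambda> n)) (muntz_series a) sequentially"
proof (cases "0 \<le> \<rho>")
  case True
  show ?thesis
    unfolding muntz_series_def
    by (rule Weierstrass_m_test[OF _ subexponential_summable[OF a True \<rho>]]) (auto intro: norm_muntz_term_le)
qed auto

text \<open>The partial sums are holomorphic off the branch cut and converge locally
  uniformly.\<close>

lemma muntz_series_analytic:
  assumes a: "subexponential a"
  shows "muntz_series a analytic_on slit_disk"
proof -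
  have op: "open slit_disk"
    unfolding slit_disk_eq by (intro open_Diff open_ball closed_nonpos_Reals_complex)
  have "muntz_series a holomorphic_on slit_disk"
  proof (rule holomorphic_uniform_sequence[OF op])
    show "(\<lambda>z. \<Sum>n<N. a n * z powr complex_of_real (\<Lambda> n)) holomorphic_on slit_disk" for N
      unfolding slit_disk_eq by (intro holomorphic_intros) auto
    fix z assume "z \<in> slit_disk"
    then obtain d where d: "0 < d" "cball z d \<subseteq> slit_disk"
      using op open_contains_cball by blast
    then have "cball z d \<subseteq> ball 0 1" by (auto simp: slit_disk_def)
    then obtain \<rho> where "\<rho> < 1" "cball z d \<subseteq> cball 0 \<rho>"
      using compact_subset_cball[OF compact_cball] by metis
    then show "\<exists>d>0. cball z d \<subseteq> slit_disk \<and>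
        uniform_limit (cball z d) (\<lambda>N z. \<Sum>n<N. a n * z powr complex_of_real (\<Lambda> n)) (muntz_series a) sequentially"
      using d uniform_limit_on_subset[OF muntz_series_uniform_limit[OF a]] by blast
  qed
  then show ?thesis using op by (simp add: analytic_on_open)
qed

end

section \<open>Expansion of functions in the Muntz space\<close>

locale muntz_biorthogonal = muntz_exponents +
  fixes r :: "nat \<Rightarrow> real \<Rightarrow> complex"
  assumes biorth: "biorthogonal_family (muntz_space \<Lambda>) (muntz_system \<Lambda>) r"
begin

abbreviation coef :: "(real \<Rightarrow> complex) \<Rightarrow> nat \<Rightarrow> complex" where
  "coef f n \<equiv> L2_inner f (r n)"

lemma r_mem: "r n \<in> muntz_space \<Lambda>"
  using biorth by (simp add: biorthogonal_family_def)

lemma r_L2: "r n \<in> L2_01"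
  using r_mem closed_span_L2 unfolding muntz_space_def by blast

lemma muntz_L2: "muntz_system \<Lambda> n \<in> L2_01"
  using range_L2 by auto

lemma space_L2: "f \<in> muntz_space \<Lambda> \<Longrightarrow> f \<in> L2_01"
  unfolding muntz_space_def by (rule closed_span_L2)

lemma coef_sum:
  assumes "finite J"
  shows "coef (\<lambda>t. \<Sum>k\<in>J. c k * muntz_system \<Lambda> k t) n = (if n \<in> J then c n else 0)"
proof -
  have "coef (\<lambda>t. \<Sum>k\<in>J. c k * muntz_system \<Lambda> k t) n = (\<Sum>k\<in>J. c k * coef (muntz_system \<Lambda> k) n)"
    using muntz_L2 r_L2 by (intro L2_inner_sum_left)
  also have "\<dots> = (\<Sum>k\<in>J. if k = n then c k else 0)"
    using biorth by (intro sum.cong) (auto simp: biorthogonal_family_def)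
  finally show ?thesis using assms by (simp add: sum.delta)
qed

lemma coef_diff:
  assumes "f \<in> L2_01" "g \<in> L2_01"
  shows "coef (\<lambda>t. f t - g t) n = coef f n - coef g n"
  using assms r_L2 by (rule L2_inner_diff_left)

text \<open>The bound on the span extends to the closure because each coefficient functional is
  continuous. The constant is uniform in \<open>f\<close> and \<open>n\<close>.\<close>

lemma coef_le:
  assumes \<epsilon>: "0 < \<epsilon>"
  shows "\<exists>C>0. \<forall>f\<in>muntz_space \<Lambda>. \<forall>n. cmod (coef f n) \<le> C * exp (\<epsilon> * \<Lambda> n) * L2_norm f"
proof -
  obtain C where C: "0 < C" "\<And>J c n. finite J \<Longrightarrow> n \<in> J \<Longrightarrow>
      cmod (c n) \<le> C * exp (\<epsilon> * \<Lambda> n) * L2_norm (\<lambda>t. \<Sum>k\<in>J. c k * muntz_system \<Lambda> k t)"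
    using muntz_coefficient_le[OF \<epsilon>] by blast
  have "cmod (coef f n) \<le> C * exp (\<epsilon> * \<Lambda> n) * L2_norm f" if f: "f \<in> muntz_space \<Lambda>" for f n
  proof (rule field_le_epsilon)
    define D where "D = C * exp (\<epsilon> * \<Lambda> n)"
    have D: "0 < D" using C by (simp add: D_def)
    \<comment> \<open>The approximation error enters through the norm of \<open>g\<close>, with
      factor \<open>D\<close>, and through the coefficient of \<open>f - g\<close>, with factor
      \<open>L2_norm (r n)\<close>.\<close>
    define R where "R = D + L2_norm (r n)"
    have R: "0 < R" using D L2_norm_nonneg[of "r n"] by (simp add: R_def add_pos_nonneg)
    fix e :: real assume "0 < e"
    then have "0 < e / R" using R by simp
    then obtain g where g: "g \<in> complex_span (range (muntz_system \<Lambda>))" "L2_norm (\<lambda>t. f t - g t) < e / R"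
      using f unfolding muntz_space_def by (metis closed_span_approx)
    have fL: "f \<in> L2_01" and gL: "g \<in> L2_01"
      using space_L2[OF f] complex_span_L2[OF range_L2 g(1)] .
    obtain J c where J: "finite J" "g = (\<lambda>t. \<Sum>k\<in>J. c k * muntz_system \<Lambda> k t)"
      using complex_span_image_obtains[OF g(1)] by blast
    have cg: "cmod (coef g n) \<le> D * L2_norm g"
      using C(2)[OF J(1), of n c] coef_sum[OF J(1), of c n] D L2_norm_nonneg[of g]
      by (auto simp: D_def J(2))
    have "cmod (coef f n) \<le> cmod (coef g n) + cmod (coef (\<lambda>t. f t - g t) n)"
      unfolding coef_diff[OF fL gL] using norm_triangle_ineq[of "coef g n" "coef f n - coef g n"] by simp
    also have "\<dots> \<le> D * L2_norm g + L2_norm (\<lambda>t. f t - g t) * L2_norm (r n)"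
      using cg L2_Cauchy_Schwarz[OF L2_01_diff[OF fL gL] r_L2] by (rule add_mono)
    also have "L2_norm g \<le> L2_norm f + L2_norm (\<lambda>t. f t - g t)"
      using L2_norm_triangle[OF fL L2_01_diff[OF gL fL]] by (simp add: L2_norm_minus_commute[of g f])
    then have "D * L2_norm g + L2_norm (\<lambda>t. f t - g t) * L2_norm (r n) \<le>
        D * (L2_norm f + L2_norm (\<lambda>t. f t - g t)) + L2_norm (\<lambda>t. f t - g t) * L2_norm (r n)"
      using D by (intro add_right_mono mult_left_mono) auto
    also have "\<dots> = D * L2_norm f + R * L2_norm (\<lambda>t. f t - g t)"
      by (simp add: R_def algebra_simps)
    also have "\<dots> \<le> D * L2_norm f + e"
      using g(2) R by (simp add: pos_less_divide_eq mult.commute)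
    finally show "cmod (coef f n) \<le> C * exp (\<epsilon> * \<Lambda> n) * L2_norm f + e"
      by (simp add: D_def)
  qed
  with C(1) show ?thesis by blast
qed

text \<open>Every \<open>r n\<close> lies in the Muntz space, so coefficients see only the
  orthogonal projection onto it. This carries results over to all of \<open>L2_01\<close>.\<close>

lemma coef_projection:
  assumes f: "f \<in> L2_01"
  shows "\<exists>g\<in>muntz_space \<Lambda>. \<forall>n. coef f n = coef g n"
proof -
  obtain g where g: "g \<in> muntz_space \<Lambda>"
    and orth: "\<And>h. h \<in> range (muntz_system \<Lambda>) \<Longrightarrow> L2_inner (\<lambda>t. f t - g t) h = 0"
    using L2_projection[OF range_L2 f] unfolding muntz_space_def by blast
  have d: "(\<lambda>t. f t - g t) \<in> L2_01" by (intro L2_01_diff f space_L2 g)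
  have "coef (\<lambda>t. f t - g t) n = 0" for n
  proof -
    have "L2_inner h (\<lambda>t. f t - g t) = 0" if "h \<in> range (muntz_system \<Lambda>)" for h
      using orth[OF that] by (subst L2_inner_commute) simp
    then have "L2_inner (r n) (\<lambda>t. f t - g t) = 0"
      using closed_span_orthogonal[OF range_L2 r_mem[unfolded muntz_space_def] d] by blast
    then show ?thesis by (subst L2_inner_commute) simp
  qed
  with g show ?thesis using coef_diff[OF f space_L2[OF g]] by force
qed

lemma subexponential_coef:
  assumes f: "f \<in> L2_01"
  shows "subexponential (coef f)"
  unfolding subexponential_def
proof (intro allI impI)
  fix \<epsilon> :: real assume "0 < \<epsilon>"
  obtain g where g: "g \<in> muntz_space \<Lambda>" "\<And>n. coef f n = coef g n"
    using coef_projection[OF f] by blast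
  obtain C where C: "\<And>n. cmod (coef g n) \<le> C * exp (\<epsilon> * \<Lambda> n) * L2_norm g"
    using coef_le[OF \<open>0 < \<epsilon>\<close>] g(1) by blast
  then show "\<exists>C. \<forall>n. cmod (coef f n) \<le> C * exp (\<epsilon> * \<Lambda> n)"
    by (intro exI[of _ "C * L2_norm g"]) (simp add: g(2) mult_ac)
qed

text \<open>Summing the coefficient bounds makes evaluation of the series a bounded functional,
  uniformly on the disk of radius \<open>\<rho>\<close>.\<close>

lemma muntz_series_le:
  assumes \<rho>: "0 < \<rho>" "\<rho> < 1"
  shows "\<exists>C>0. \<forall>f\<in>muntz_space \<Lambda>. \<forall>z. cmod z \<le> \<rho> \<longrightarrow> cmod (muntz_series (coef f) z) \<le> C * L2_norm f"
proof -
  obtain \<epsilon> where \<epsilon>: "0 < \<epsilon>" and sm: "summable (\<lambda>n. exp (\<epsilon> * \<Lambda> n) * \<rho> powr \<Lambda> n)"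
    using summable_exp_powr[OF \<rho>] .
  obtain C where C: "0 < C" "\<And>f n. f \<in> muntz_space \<Lambda> \<Longrightarrow> cmod (coef f n) \<le> C * exp (\<epsilon> * \<Lambda> n) * L2_norm f"
    using coef_le[OF \<epsilon>] by blast
  define T where "T = (\<Sum>n. exp (\<epsilon> * \<Lambda> n) * \<rho> powr \<Lambda> n)"
  have T: "0 < T" unfolding T_def using \<rho> by (intro suminf_pos sm) simp
  have "cmod (muntz_series (coef f) z) \<le> C * T * L2_norm f"
    if f: "f \<in> muntz_space \<Lambda>" and z: "cmod z \<le> \<rho>" for f z
  proof -
    let ?g = "\<lambda>n. (C * L2_norm f) * (exp (\<epsilon> * \<Lambda> n) * \<rho> powr \<Lambda> n)"
    have le: "cmod (coef f n * z powr complex_of_real (\<Lambda> n)) \<le> ?g n" for n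
    proof -
      have "cmod (coef f n * z powr complex_of_real (\<Lambda> n)) \<le> cmod (coef f n) * \<rho> powr \<Lambda> n"
        using norm_muntz_term_le[OF z] .
      also have "\<dots> \<le> (C * exp (\<epsilon> * \<Lambda> n) * L2_norm f) * \<rho> powr \<Lambda> n"
        using C(2)[OF f] by (intro mult_right_mono) auto
      finally show ?thesis by (simp add: mult_ac)
    qed
    have "cmod (muntz_series (coef f) z) \<le> (\<Sum>n. ?g n)"
      unfolding muntz_series_def using le by (rule norm_suminf_le) (intro summable_mult sm)
    also have "\<dots> = C * T * L2_norm f"
      unfolding T_def by (subst suminf_mult[OF sm]) (simp add: mult_ac)
    finally show ?thesis .
  qed
  then show ?thesis using C(1) T by (intro exI[of _ "C * T"]) auto
qed

lemma muntz_series_span: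
  assumes p: "p \<in> complex_span (range (muntz_system \<Lambda>))" and t: "0 \<le> t"
  shows "muntz_series (coef p) (complex_of_real t) = p t"
proof -
  obtain J c where J: "finite J" "p = (\<lambda>t. \<Sum>k\<in>J. c k * muntz_system \<Lambda> k t)"
    using complex_span_image_obtains[OF p] by blast
  have c: "coef p n = (if n \<in> J then c n else 0)" for n
    unfolding J(2) by (rule coef_sum[OF J(1)])
  have "muntz_series (coef p) (complex_of_real t) = (\<Sum>n\<in>J. coef p n * complex_of_real t powr complex_of_real (\<Lambda> n))"
    unfolding muntz_series_def using J(1) by (rule suminf_finite) (simp add: c)
  also have "\<dots> = p t"
    unfolding J(2) using t c by (intro sum.cong) (auto simp: J(2) muntz_system_def powr_of_real)
  finally show ?thesis .
qed

lemma muntz_series_diff: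
  assumes "f \<in> L2_01" "g \<in> L2_01" "cmod z < 1"
  shows "muntz_series (coef (\<lambda>t. f t - g t)) z = muntz_series (coef f) z - muntz_series (coef g) z"
  using sums_diff[OF muntz_series_sums[OF subexponential_coef[OF assms(1)] assms(3)]
      muntz_series_sums[OF subexponential_coef[OF assms(2)] assms(3)]]
  unfolding muntz_series_def
  by (simp add: coef_diff[OF assms(1,2)] left_diff_distrib sums_iff)

section \<open>The series represents the function\<close>

text \<open>This will be a representative of \<open>f\<close> with values given by the series at
  every point, so that its dilations expand termwise.\<close>

definition extension :: "(real \<Rightarrow> complex) \<Rightarrow> real \<Rightarrow> complex" where
  "extension f t = muntz_series (coef f) (complex_of_real t)"

text \<open>The evaluation bound is applied to \<open>f - p\<close>; on the span the series returns
  \<open>p\<close> itself.\<close>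

lemma extension_near_span:
  assumes \<rho>: "0 < \<rho>" "\<rho> < 1"
  shows "\<exists>C>0. \<forall>f\<in>muntz_space \<Lambda>. \<forall>p\<in>complex_span (range (muntz_system \<Lambda>)). \<forall>t\<in>{0..\<rho>}.
    cmod (extension f t - p t) \<le> C * L2_norm (\<lambda>t. f t - p t)"
proof -
  obtain C where C: "0 < C"
    "\<And>f z. f \<in> muntz_space \<Lambda> \<Longrightarrow> cmod z \<le> \<rho> \<Longrightarrow> cmod (muntz_series (coef f) z) \<le> C * L2_norm f"
    using muntz_series_le[OF \<rho>] by blast
  have "cmod (extension f t - p t) \<le> C * L2_norm (\<lambda>t. f t - p t)"
    if f: "f \<in> muntz_space \<Lambda>" and p: "p \<in> complex_span (range (muntz_system \<Lambda>))" and t: "t \<in> {0..\<rho>}" for f p t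
  proof -
    have pm: "p \<in> muntz_space \<Lambda>"
      using complex_span_subset_closed_span[OF range_L2] p unfolding muntz_space_def by blast
    have d: "(\<lambda>t. f t - p t) \<in> muntz_space \<Lambda>"
      using f pm unfolding muntz_space_def by (intro closed_span_diff range_L2)
    have "muntz_series (coef (\<lambda>t. f t - p t)) (complex_of_real t) = extension f t - p t"
      using t \<rho> by (subst muntz_series_diff[OF space_L2[OF f] space_L2[OF pm]])
        (simp_all add: extension_def muntz_series_span[OF p])
    then show ?thesis using C(2)[OF d, of "complex_of_real t"] t by simp
  qed
  then show ?thesis using C(1) by blast
qed

lemma extension_measurable:
  assumes f: "f \<in> L2_01"
  shows "extension f \<in> borel_measurable unit_lebesgue"
proof -
  have "continuous_on slit_disk (muntz_series (coef f))"
    using muntz_series_analytic[OF subexponential_coef[OF f]]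
    by (intro holomorphic_on_imp_continuous_on analytic_imp_holomorphic)
  moreover have "complex_of_real ` {0<..<1} \<subseteq> slit_disk"
    by (auto simp: slit_disk_def)
  ultimately have "continuous_on {0<..<1} (\<lambda>t. muntz_series (coef f) (complex_of_real t))"
    by (rule continuous_on_compose2[OF _ continuous_on_of_real_id])
  then show ?thesis
    unfolding extension_def[abs_def] by (intro continuous_imp_measurable_on_sets_lebesgue) auto
qed

text \<open>On \<open>{0<..\<rho>}\<close> both \<open>f\<close> and its series are close in norm to
  any \<open>p\<close> close to \<open>f\<close>, so their difference has norm zero there. Then
  \<open>\<rho>\<close> tends to \<open>1\<close> along a sequence.\<close>

lemma extension_AE:
  assumes f: "f \<in> muntz_space \<Lambda>"
  shows "AE t in unit_lebesgue. f t = extension f t"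
proof -
  have fL: "f \<in> L2_01" using space_L2[OF f] .
  note [measurable] = L2_01D(1)[OF fL] extension_measurable[OF fL]
  have [measurable]: "(\<lambda>t. t) \<in> borel_measurable unit_lebesgue"
    by (rule borel_measurable_unit_lebesgue) simp
  have ae: "AE t in unit_lebesgue. t \<le> \<rho> \<longrightarrow> f t = extension f t" if \<rho>: "0 < \<rho>" "\<rho> < 1" for \<rho>
  proof -
    obtain C where C: "0 < C" "\<And>p t. p \<in> complex_span (range (muntz_system \<Lambda>)) \<Longrightarrow> t \<in> {0..\<rho>} \<Longrightarrow>
        cmod (extension f t - p t) \<le> C * L2_norm (\<lambda>t. f t - p t)"
      using extension_near_span[OF \<rho>] f by blast
    \<comment> \<open>The series is not yet known to be square integrable up to \<open>1\<close>,
      hence the cut at \<open>\<rho>\<close>.\<close>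
    define u where "u t = (if t \<le> \<rho> then f t - extension f t else 0)" for t
    have u: "u \<in> L2_01 \<and> L2_norm u \<le> (1 + C) * L2_norm (\<lambda>t. f t - p t)"
      if p: "p \<in> complex_span (range (muntz_system \<Lambda>))" for p
    proof -
      have pL: "p \<in> L2_01" using complex_span_L2[OF range_L2 p] .
      note [measurable] = L2_01D(1)[OF pL]
      define v where "v t = (if t \<le> \<rho> then f t - p t else 0)" for t
      define w where "w t = (if t \<le> \<rho> then p t - extension f t else 0)" for t
      have [measurable]: "v \<in> borel_measurable unit_lebesgue" "w \<in> borel_measurable unit_lebesgue"
        unfolding v_def[abs_def] w_def[abs_def] by measurable
      have v: "v \<in> L2_01" "L2_norm v \<le> L2_norm (\<lambda>t. f t - p t)"
        using L2_norm_mono[of v "\<lambda>t. f t - p t"] L2_01_diff[OF fL pL] by (auto simp: v_def)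
      have w: "w \<in> L2_01" "L2_norm w \<le> C * L2_norm (\<lambda>t. f t - p t)"
        using L2_norm_bound[of w "C * L2_norm (\<lambda>t. f t - p t)"] C L2_norm_nonneg[of "\<lambda>t. f t - p t"] p
        by (auto simp: w_def norm_minus_commute)
      have "u = (\<lambda>t. v t + w t)" by (auto simp: u_def v_def w_def)
      then show ?thesis
        using L2_01_add[OF v(1) w(1)] L2_norm_triangle[OF v(1) w(1)] v(2) w(2) by (simp add: distrib_right)
    qed
    have uL: "u \<in> L2_01" using u[OF complex_span_zero] by blast
    have "L2_norm u \<le> 0"
    proof (rule field_le_epsilon)
      fix e :: real assume "0 < e"
      then have "0 < e / (1 + C)" using C by simp
      then obtain p where p: "p \<in> complex_span (range (muntz_system \<Lambda>))" "L2_norm (\<lambda>t. f t - p t) < e / (1 + C)"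
        using f unfolding muntz_space_def by (metis closed_span_approx)
      have "(1 + C) * L2_norm (\<lambda>t. f t - p t) \<le> e"
        using p(2) C by (simp add: pos_less_divide_eq mult.commute)
      then show "L2_norm u \<le> 0 + e" using u[OF p(1)] by linarith
    qed
    then have "L2_norm u = 0" using L2_norm_nonneg[of u] by linarith
    then have "AE t in unit_lebesgue. u t = 0" using L2_norm_zero_iff_AE[OF uL] by blast
    then show ?thesis by eventually_elim (auto simp: u_def split: if_splits)
  qed
  \<comment> \<open>The summand \<open>2\<close> keeps the cut strictly between \<open>0\<close> and
    \<open>1\<close> also for \<open>k = 0\<close>.\<close>
  have "AE t in unit_lebesgue. \<forall>k::nat. t \<le> 1 - 1 / (real k + 2) \<longrightarrow> f t = extension f t"
    unfolding AE_all_countable by (intro allI ae) (auto simp: field_simps)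
  moreover have "AE t in unit_lebesgue. t < 1"
    by (rule AE_I2) simp
  ultimately show ?thesis
  proof eventually_elim
    case (elim t)
    obtain k where "1 / (1 - t) < real k" using reals_Archimedean2 by blast
    then have "1 < real k * (1 - t)" using elim(2) by (simp add: field_simps)
    also have "\<dots> \<le> (real k + 2) * (1 - t)" using elim(2) by (intro mult_right_mono) auto
    finally have "1 / (real k + 2) < 1 - t" by (simp add: field_simps)
    then have "t \<le> 1 - 1 / (real k + 2)" by simp
    with elim(1) show ?case by blast
  qed
qed

lemma extension_L2:
  assumes "f \<in> muntz_space \<Lambda>"
  shows "extension f \<in> L2_01"
  using L2_01_cong_AE[OF space_L2[OF assms] extension_AE[OF assms]] .

section \<open>Approximation by dilations\<close>

text \<open>The dilated argument stays in the disk of radius \<open>s < 1\<close>, where the series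
  converges uniformly; its partial sums involve only indices in \<open>A\<close>.\<close>

lemma dilation_mem_closed_span:
  assumes f: "f \<in> muntz_space \<Lambda>" and zero: "\<And>n. n \<notin> A \<Longrightarrow> coef f n = 0" and s: "0 < s" "s < 1"
  shows "(\<lambda>t. extension f (s * t)) \<in> closed_span (muntz_system \<Lambda> ` A)"
proof (rule closed_span_closed)
  show S: "muntz_system \<Lambda> ` A \<subseteq> L2_01" using muntz_L2 by auto
  have fL: "f \<in> L2_01" using space_L2[OF f] .
  show dL: "(\<lambda>t. extension f (s * t)) \<in> L2_01"
    using L2_norm_dilation_le(1)[OF extension_L2[OF f]] s by simp
  define P where "P N t = (\<Sum>n<N. coef f n * complex_of_real (s powr \<Lambda> n) * muntz_system \<Lambda> n t)" for N t
  fix \<epsilon> :: real assume \<epsilon>: "0 < \<epsilon>"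
  have "eventually (\<lambda>N. \<forall>z\<in>cball 0 s. dist (\<Sum>n<N. coef f n * z powr complex_of_real (\<Lambda> n)) (muntz_series (coef f) z) < \<epsilon> / 2) sequentially"
    using muntz_series_uniform_limit[OF subexponential_coef[OF fL] s(2)] half_gt_zero[OF \<epsilon>]
    unfolding uniform_limit_iff by blast
  then obtain N where N: "\<forall>z\<in>cball 0 s. dist (\<Sum>n<N. coef f n * z powr complex_of_real (\<Lambda> n)) (muntz_series (coef f) z) < \<epsilon> / 2"
    unfolding eventually_sequentially by blast
  have P: "P N \<in> complex_span (muntz_system \<Lambda> ` A)"
    unfolding P_def
  proof (rule complex_span_sum)
    fix n
    show "(\<lambda>t. coef f n * complex_of_real (s powr \<Lambda> n) * muntz_system \<Lambda> n t) \<in> complex_span (muntz_system \<Lambda> ` A)"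
    proof (cases "n \<in> A")
      case True
      then show ?thesis
        by (intro complex_span_scale subsetD[OF complex_span_superset] imageI)
    next
      case False
      then show ?thesis using complex_span_zero by (simp add: zero)
    qed
  qed
  have le: "cmod (extension f (s * t) - P N t) \<le> \<epsilon> / 2" if t: "t \<in> {0<..<1}" for t
  proof -
    have "P N t = (\<Sum>n<N. coef f n * complex_of_real (s * t) powr complex_of_real (\<Lambda> n))"
      unfolding P_def using s t
      by (intro sum.cong) (auto simp: muntz_system_def powr_of_real powr_mult simp del: of_real_mult simp flip: of_real_mult)
    moreover have "cmod (complex_of_real (s * t)) \<le> s"
      using s t by (simp add: norm_mult mult_left_le)
    ultimately show ?thesis
      using bspec[OF N, of "complex_of_real (s * t)"] by (simp add: extension_def dist_norm norm_minus_commute)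
  qed
  have "L2_norm (\<lambda>t. extension f (s * t) - P N t) \<le> \<epsilon> / 2"
    using L2_norm_bound(2)[OF L2_01D(1)[OF L2_01_diff[OF dL complex_span_L2[OF S P]]] _ le] \<epsilon> by simp
  also have "\<dots> < \<epsilon>" using \<epsilon> by simp
  finally show "\<exists>g\<in>closed_span (muntz_system \<Lambda> ` A). L2_norm (\<lambda>t. extension f (s * t) - g t) < \<epsilon>"
    using complex_span_subset_closed_span[OF S] P by blast
qed

text \<open>A dilation multiplies each power by \<open>s powr \<Lambda> k\<close>, so
  \<open>B s\<close> bounds the difference uniformly on the interval.\<close>

lemma span_dilation_tendsto:
  assumes p: "p \<in> complex_span (range (muntz_system \<Lambda>))"
  shows "((\<lambda>s. L2_norm (\<lambda>t. p (s * t) - p t)) \<longlongrightarrow> 0) (at_left 1)"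
proof -
  obtain J c where J: "finite J" "p = (\<lambda>t. \<Sum>k\<in>J. c k * muntz_system \<Lambda> k t)"
    using complex_span_image_obtains[OF p] by blast
  define B where "B s = (\<Sum>k\<in>J. cmod (c k) * \<bar>s powr \<Lambda> k - 1\<bar>)" for s
  have "(B \<longlongrightarrow> (\<Sum>k\<in>J. cmod (c k) * \<bar>1 powr \<Lambda> k - 1\<bar>)) (at_left 1)"
    unfolding B_def by (intro tendsto_intros) auto
  then have B: "(B \<longlongrightarrow> 0) (at_left 1)" by simp
  have "eventually (\<lambda>s::real. s \<in> {0<..<1}) (at_left 1)"
    by (rule eventually_at_leftI[of 0]) auto
  then have "eventually (\<lambda>s. norm (L2_norm (\<lambda>t. p (s * t) - p t)) \<le> B s) (at_left 1)"
  proof eventually_elim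
    case (elim s)
    have pL: "p \<in> L2_01" using complex_span_L2[OF range_L2 p] .
    have "L2_norm (\<lambda>t. p (s * t) - p t) \<le> B s"
    proof (rule L2_norm_bound(2))
      show "(\<lambda>t. p (s * t) - p t) \<in> borel_measurable unit_lebesgue"
        using elim by (intro L2_01D(1) L2_01_diff L2_norm_dilation_le(1) pL) auto
      show "0 \<le> B s" unfolding B_def by (intro sum_nonneg) auto
      fix t :: real assume t: "t \<in> {0<..<1}"
      have "p (s * t) - p t = (\<Sum>k\<in>J. c k * complex_of_real ((s powr \<Lambda> k - 1) * t powr \<Lambda> k))"
        unfolding J(2) sum_subtractf[symmetric] using t elim
        by (intro sum.cong) (auto simp: muntz_system_def powr_mult algebra_simps)
      also have "cmod \<dots> \<le> (\<Sum>k\<in>J. cmod (c k * complex_of_real ((s powr \<Lambda> k - 1) * t powr \<Lambda> k)))"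
        by (rule norm_sum)
      also have "\<dots> \<le> B s"
        unfolding B_def
      proof (rule sum_mono)
        fix k
        have "t powr \<Lambda> k \<le> 1" using t pos[of k] by (simp add: powr_le1)
        then have "\<bar>s powr \<Lambda> k - 1\<bar> * t powr \<Lambda> k \<le> \<bar>s powr \<Lambda> k - 1\<bar>"
          by (intro mult_left_le) auto
        then have "cmod (c k) * (\<bar>s powr \<Lambda> k - 1\<bar> * t powr \<Lambda> k) \<le> cmod (c k) * \<bar>s powr \<Lambda> k - 1\<bar>"
          by (intro mult_left_mono) auto
        then show "cmod (c k * complex_of_real ((s powr \<Lambda> k - 1) * t powr \<Lambda> k)) \<le> cmod (c k) * \<bar>s powr \<Lambda> k - 1\<bar>"
          by (simp only: norm_mult norm_of_real abs_mult) simp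
      qed
      finally show "cmod (p (s * t) - p t) \<le> B s" .
    qed
    then show ?case using L2_norm_nonneg by simp
  qed
  then show ?thesis using B by (rule Lim_null_comparison)
qed

text \<open>Dilations converge to the identity on the span and are bounded by \<open>2\<close> in
  norm for \<open>s > 1/4\<close>, so they also converge at \<open>f\<close>; the dilations of its
  series lie in the closed span already.\<close>

lemma mem_closed_span_support:
  assumes f: "f \<in> muntz_space \<Lambda>" and zero: "\<And>n. n \<notin> A \<Longrightarrow> coef f n = 0"
  shows "f \<in> closed_span (muntz_system \<Lambda> ` A)"
proof (rule closed_span_closed)
  show S: "muntz_system \<Lambda> ` A \<subseteq> L2_01" using muntz_L2 by auto
  show fL: "f \<in> L2_01" using space_L2[OF f] .
  have xL: "extension f \<in> L2_01" using extension_L2[OF f] .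
  fix \<epsilon> :: real assume \<epsilon>: "0 < \<epsilon>"
  \<comment> \<open>The errors are one fifth for replacing \<open>f\<close> by \<open>p\<close>, one
    fifth for dilating \<open>p\<close>, and two fifths for the dilated difference.\<close>
  then have "0 < \<epsilon> / 5" by simp
  then obtain p where p: "p \<in> complex_span (range (muntz_system \<Lambda>))" "L2_norm (\<lambda>t. f t - p t) < \<epsilon> / 5"
    using f unfolding muntz_space_def by (metis closed_span_approx)
  have pL: "p \<in> L2_01" using complex_span_L2[OF range_L2 p(1)] .
  have xp: "L2_norm (\<lambda>t. extension f t - p t) = L2_norm (\<lambda>t. f t - p t)"
    using extension_AE[OF f] by (intro L2_norm_cong_AE[symmetric] L2_01_diff fL pL) (auto elim: eventually_mono)
  have "eventually (\<lambda>s. L2_norm (\<lambda>t. p (s * t) - p t) < \<epsilon> / 5) (at_left 1)"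
    using order_tendstoD(2)[OF span_dilation_tendsto[OF p(1)]] \<open>0 < \<epsilon> / 5\<close> by blast
  moreover have "eventually (\<lambda>s::real. s \<in> {1/4<..<1}) (at_left 1)"
    by (rule eventually_at_leftI[of "1/4"]) auto
  ultimately have "eventually (\<lambda>s. L2_norm (\<lambda>t. p (s * t) - p t) < \<epsilon> / 5 \<and> s \<in> {1/4<..<1}) (at_left 1)"
    by (rule eventually_conj)
  then obtain s where s: "L2_norm (\<lambda>t. p (s * t) - p t) < \<epsilon> / 5" "1 / 4 < s" "s < 1"
    using eventually_happens[of _ "at_left (1::real)"] by auto
  have psL: "(\<lambda>t. p (s * t)) \<in> L2_01" and xsL: "(\<lambda>t. extension f (s * t)) \<in> L2_01"
    using s L2_norm_dilation_le(1)[OF pL] L2_norm_dilation_le(1)[OF xL] by auto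
  have "sqrt (1 / 4) \<le> sqrt s" using s by (intro real_sqrt_le_mono) simp
  then have "1 / 2 \<le> sqrt s" by (simp add: real_sqrt_divide)
  then have "1 / 2 * L2_norm (\<lambda>t. extension f (s * t) - p (s * t)) \<le> sqrt s * L2_norm (\<lambda>t. extension f (s * t) - p (s * t))"
    by (rule mult_right_mono) (rule L2_norm_nonneg)
  also have "\<dots> \<le> \<epsilon> / 5"
    using L2_norm_dilation_le(2)[OF L2_01_diff[OF xL pL], of s] s xp p(2) by simp
  finally have 1: "L2_norm (\<lambda>t. extension f (s * t) - p (s * t)) \<le> 2 * (\<epsilon> / 5)" by simp
  have "L2_norm (\<lambda>t. f t - extension f (s * t)) \<le> L2_norm (\<lambda>t. f t - p t) + L2_norm (\<lambda>t. p t - extension f (s * t))"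
    by (rule L2_norm_triangle_diff[OF fL pL xsL])
  also have "L2_norm (\<lambda>t. p t - extension f (s * t)) \<le> L2_norm (\<lambda>t. p t - p (s * t)) + L2_norm (\<lambda>t. p (s * t) - extension f (s * t))"
    by (rule L2_norm_triangle_diff[OF pL psL xsL])
  finally have "L2_norm (\<lambda>t. f t - extension f (s * t)) < \<epsilon>"
    using 1 s(1) p(2) \<epsilon> L2_norm_minus_commute[of p "\<lambda>t. p (s * t)"]
      L2_norm_minus_commute[of "\<lambda>t. p (s * t)" "\<lambda>t. extension f (s * t)"] by linarith
  then show "\<exists>g\<in>closed_span (muntz_system \<Lambda> ` A). L2_norm (\<lambda>t. f t - g t) < \<epsilon>"
    using s by (intro bexI[OF _ dilation_mem_closed_span[OF f zero]]) auto
qed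

section \<open>Hereditary completeness\<close>

text \<open>The remainder of \<open>f\<close> after projection onto the mixed span is orthogonal to
  itself: the \<open>r n\<close> with \<open>n\<close> in \<open>N2\<close> confine its expansion to
  \<open>N1\<close>, and the powers from \<open>N1\<close> annihilate the rest.\<close>

lemma mixed_system_complete:
  assumes N: "N1 \<union> N2 = UNIV"
  shows "closed_span (muntz_system \<Lambda> ` N1 \<union> r ` N2) = muntz_space \<Lambda>"
proof
  let ?S = "muntz_system \<Lambda> ` N1 \<union> r ` N2"
  have S: "?S \<subseteq> L2_01" using muntz_L2 r_L2 by auto
  have SH: "?S \<subseteq> muntz_space \<Lambda>"
    using closed_span_superset[OF range_L2] r_mem unfolding muntz_space_def by auto
  then show sub: "closed_span ?S \<subseteq> muntz_space \<Lambda>"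
    unfolding muntz_space_def by (rule closed_span_minimal[OF _ range_L2])
  show "muntz_space \<Lambda> \<subseteq> closed_span ?S"
  proof
    fix f assume f: "f \<in> muntz_space \<Lambda>"
    obtain g where g: "g \<in> closed_span ?S" and orth: "\<And>h. h \<in> ?S \<Longrightarrow> L2_inner (\<lambda>t. f t - g t) h = 0"
      using L2_projection[OF S space_L2[OF f]] by blast
    let ?d = "\<lambda>t. f t - g t"
    have gH: "g \<in> muntz_space \<Lambda>" using g sub by blast
    have d: "?d \<in> muntz_space \<Lambda>"
      using f gH unfolding muntz_space_def by (intro closed_span_diff range_L2)
    have dL: "?d \<in> L2_01" using space_L2[OF d] .
    \<comment> \<open>An index outside \<open>N1\<close> lies in \<open>N2\<close>, so its
      coefficient vanishes by orthogonality.\<close>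
    have "?d \<in> closed_span (muntz_system \<Lambda> ` N1)"
      using N orth by (intro mem_closed_span_support d) blast
    moreover have "L2_inner h ?d = 0" if "h \<in> muntz_system \<Lambda> ` N1" for h
      using orth[of h] that by (subst L2_inner_commute) simp
    moreover have "muntz_system \<Lambda> ` N1 \<subseteq> L2_01" using S by blast
    ultimately have "L2_inner ?d ?d = 0"
      using closed_span_orthogonal[OF _ _ dL] by blast
    then have "L2_norm ?d = 0" by (simp add: L2_inner_self)
    then have "AE t in unit_lebesgue. g t = f t"
      using L2_norm_zero_iff_AE[OF dL] by (auto elim: eventually_mono)
    then show "f \<in> closed_span ?S" by (rule closed_span_cong_AE[OF S g])
  qed
qed

section \<open>The associated series on the slit disk\<close>

lemma series_term_eq: "series_term \<Lambda> r f z n = coef f n * z powr complex_of_real (\<Lambda> n)"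
  by (simp add: series_term_def)

lemma assoc_series_eq: "assoc_series \<Lambda> r f = muntz_series (coef f)"
  by (auto simp: assoc_series_def muntz_series_def series_term_eq)

text \<open>Convergence rests on estimates over full disks and therefore includes the origin;
  analyticity is claimed on the open set \<open>slit_disk\<close>.\<close>

lemma space_extension:
  assumes f: "f \<in> muntz_space \<Lambda>"
  shows "\<exists>F. F analytic_on slit_disk \<and>
    (AE t in unit_lebesgue. f t = F (complex_of_real t)) \<and>
    (\<forall>z\<in>slit_disk0. series_term \<Lambda> r f z sums F z) \<and>
    (\<forall>K. compact K \<and> K \<subseteq> slit_disk0 \<longrightarrow>
      uniform_limit K (\<lambda>N z. \<Sum>n<N. series_term \<Lambda> r f z n) F sequentially)"
proof (intro exI[of _ "muntz_series (coef f)"] conjI ballI allI impI)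
  have a: "subexponential (coef f)" using subexponential_coef[OF space_L2[OF f]] .
  show "muntz_series (coef f) analytic_on slit_disk" by (rule muntz_series_analytic[OF a])
  show "AE t in unit_lebesgue. f t = muntz_series (coef f) (complex_of_real t)"
    using extension_AE[OF f] by (simp add: extension_def)
  show "series_term \<Lambda> r f z sums muntz_series (coef f) z" if "z \<in> slit_disk0" for z
    using muntz_series_sums[OF a, of z] that by (simp add: series_term_eq[abs_def] slit_disk0_def)
  fix K assume K: "compact K \<and> K \<subseteq> slit_disk0"
  then have "K \<subseteq> ball 0 1" by (auto simp: slit_disk0_def)
  then obtain \<rho> where "\<rho> < 1" "K \<subseteq> cball 0 \<rho>"
    using compact_subset_cball K by metis
  then show "uniform_limit K (\<lambda>N z. \<Sum>n<N. series_term \<Lambda> r f z n) (muntz_series (coef f)) sequentially"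
    unfolding series_term_eq by (intro uniform_limit_on_subset[OF muntz_series_uniform_limit[OF a]])
qed

text \<open>The associated series of \<open>f\<close> is that of its projection \<open>g\<close>,
  which agrees with \<open>g\<close> almost everywhere.\<close>

lemma assoc_series_mem:
  assumes f: "f \<in> L2_01"
  shows "(\<lambda>x. assoc_series \<Lambda> r f (complex_of_real x)) \<in> muntz_space \<Lambda>"
proof -
  obtain g where g: "g \<in> muntz_space \<Lambda>" "\<And>n. coef f n = coef g n"
    using coef_projection[OF f] by blast
  have "extension g \<in> muntz_space \<Lambda>"
    using g(1) unfolding muntz_space_def
    by (rule closed_span_cong_AE[OF range_L2 _ extension_AE[OF g(1)]])
  moreover have "extension g = (\<lambda>x. assoc_series \<Lambda> r f (complex_of_real x))"
    unfolding assoc_series_eq extension_def[abs_def] g(2) ..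
  ultimately show ?thesis by simp
qed

end

theorem theorem1p1:
  fixes \<Lambda> :: "nat \<Rightarrow> real"
  assumes "strict_mono \<Lambda>"
    and "\<And>n. 0 < \<Lambda> n"
    and "summable (\<lambda>n. 1 / \<Lambda> n)"
    and "0 < (INF n. \<Lambda> (Suc n) - \<Lambda> n)"
  shows
    "(\<exists>r. biorthogonal_family (muntz_space \<Lambda>) (muntz_system \<Lambda>) r) \<and>
     (\<forall>r r'. biorthogonal_family (muntz_space \<Lambda>) (muntz_system \<Lambda>) r \<and>
             biorthogonal_family (muntz_space \<Lambda>) (muntz_system \<Lambda>) r' \<longrightarrow>
             (\<forall>n. AE t in unit_lebesgue. r n t = r' n t)) \<and>
     (\<forall>r. biorthogonal_family (muntz_space \<Lambda>) (muntz_system \<Lambda>) r \<longrightarrow>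
        (\<forall>f \<in> muntz_space \<Lambda>. \<exists>F.
            F analytic_on slit_disk \<and>
            (AE t in unit_lebesgue. f t = F (complex_of_real t)) \<and>
            (\<forall>z \<in> slit_disk0. series_term \<Lambda> r f z sums F z) \<and>
            (\<forall>K. compact K \<and> K \<subseteq> slit_disk0 \<longrightarrow>
               uniform_limit K (\<lambda>N z. \<Sum>n<N. series_term \<Lambda> r f z n) F sequentially)) \<and>
        (\<forall>f \<in> L2_01.
            (\<forall>z \<in> slit_disk. summable (series_term \<Lambda> r f z)) \<and>
            assoc_series \<Lambda> r f analytic_on slit_disk \<and>
            (\<lambda>x. assoc_series \<Lambda> r f (complex_of_real x)) \<in> muntz_space \<Lambda>) \<and>
        markushevich_basis (muntz_space \<Lambda>) (muntz_system \<Lambda>) r \<and>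
        strong_markushevich_basis (muntz_space \<Lambda>) (muntz_system \<Lambda>) r)"
proof -
  define \<delta> where "\<delta> = (INF n. \<Lambda> (Suc n) - \<Lambda> n)"
  \<comment> \<open>A real infimum is a lower bound only when the set is bounded below; monotonicity
    supplies the bound \<open>0\<close>.\<close>
  have "bdd_below (range (\<lambda>n. \<Lambda> (Suc n) - \<Lambda> n))"
    using assms(1) by (intro bdd_belowI[of _ 0]) (auto simp: strict_mono_Suc_iff less_imp_le)
  then have "\<delta> \<le> \<Lambda> (Suc n) - \<Lambda> n" for n
    unfolding \<delta>_def by (rule cINF_lower) simp
  then interpret muntz_exponents \<Lambda> \<delta>
    using assms by unfold_locales (auto simp: \<delta>_def)
  have "\<exists>r. biorthogonal_family (muntz_space \<Lambda>) (muntz_system \<Lambda>) r"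
    unfolding muntz_space_def by (rule biorthogonal_family_exists[OF range_L2 muntz_system_minimal])
  moreover have "AE t in unit_lebesgue. r n t = r' n t"
    if "biorthogonal_family (muntz_space \<Lambda>) (muntz_system \<Lambda>) r"
      "biorthogonal_family (muntz_space \<Lambda>) (muntz_system \<Lambda>) r'" for r r' n
    using that unfolding muntz_space_def by (rule biorthogonal_family_unique[OF range_L2])
  moreover have "(\<forall>f \<in> muntz_space \<Lambda>. \<exists>F.
            F analytic_on slit_disk \<and>
            (AE t in unit_lebesgue. f t = F (complex_of_real t)) \<and>
            (\<forall>z \<in> slit_disk0. series_term \<Lambda> r f z sums F z) \<and>
            (\<forall>K. compact K \<and> K \<subseteq> slit_disk0 \<longrightarrow>
               uniform_limit K (\<lambda>N z. \<Sum>n<N. series_term \<Lambda> r f z n) F sequentially)) \<and>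
        (\<forall>f \<in> L2_01.
            (\<forall>z \<in> slit_disk. summable (series_term \<Lambda> r f z)) \<and>
            assoc_series \<Lambda> r f analytic_on slit_disk \<and>
            (\<lambda>x. assoc_series \<Lambda> r f (complex_of_real x)) \<in> muntz_space \<Lambda>) \<and>
        markushevich_basis (muntz_space \<Lambda>) (muntz_system \<Lambda>) r \<and>
        strong_markushevich_basis (muntz_space \<Lambda>) (muntz_system \<Lambda>) r"
    if r: "biorthogonal_family (muntz_space \<Lambda>) (muntz_system \<Lambda>) r" for r
  proof -
    interpret muntz_biorthogonal \<Lambda> \<delta> r
      using r by unfold_locales
    have sm: "summable (series_term \<Lambda> r f z)" if "f \<in> L2_01" "z \<in> slit_disk" for f z
      using muntz_series_sums[OF subexponential_coef[OF that(1)], of z] that(2)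
      by (auto simp: series_term_eq[abs_def] slit_disk_def sums_iff)
    have an: "assoc_series \<Lambda> r f analytic_on slit_disk" if "f \<in> L2_01" for f
      unfolding assoc_series_eq by (rule muntz_series_analytic[OF subexponential_coef[OF that]])
    \<comment> \<open>Completeness of the family \<open>r\<close> is the extreme mixed system that
      contains no powers.\<close>
    have mb: "markushevich_basis (muntz_space \<Lambda>) (muntz_system \<Lambda>) r"
      unfolding markushevich_basis_def
      using mixed_system_complete[of "{}" UNIV] muntz_system_minimal r by (simp add: muntz_space_def)
    have smb: "strong_markushevich_basis (muntz_space \<Lambda>) (muntz_system \<Lambda>) r"
      unfolding strong_markushevich_basis_def using mixed_system_complete r by blast
    show ?thesis
      by (intro conjI ballI space_extension sm an assoc_series_mem mb smb)
  qed
  ultimately show ?thesis by (intro conjI allI impI) blast+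
qed

end
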